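(* Assume that each local objective function $f_i$ is $L$-smooth for some $L>0$ common to all $i$. Furthermore, assume that $\inf_{x\in\mathbb{R}^d}f_i(x)=f_i^\ast>-\infty$ for each $i$, and that the global objective function $f$ is $\mu$-gradient dominated and has a minimum value denoted by $f^\ast$. Suppose $$\eta_t=\frac{2\alpha_\eta}{\mu(t+t_0)},\qquad u_t\leq\frac{\alpha_u}{\sqrt{t+t_0}}$$ for some $\alpha_\eta>1$ and $\alpha_u>0$, where $$t_0\geq\frac{2\alpha_\eta L}{\mu(1-\rho^2)}\left(\frac{32Ld}{3\mu}+9\rho\right)-1.$$ Then, using Algorithm 1, as $t\to\infty$, $$\mathbb{E}\left[f(\bar x(t))-f^\ast\right]\leq\left(\frac{32\alpha_\eta^2 L^2\Delta}{\mu^2}+\frac{6\alpha_\eta\alpha_u^2 L^2}{\mu}\right)\frac{d}{t}+o(t^{-1}),$$ $$\frac{1}{n}\sum_{i=1}^n\mathbb{E}\left[\|x^i(t)-\bar x(t)\|^2\right]\leq\frac{32\alpha_\eta^2\rho^2 L\Delta}{\mu^2(1-\rho^2)}\left(\frac{4d}{3}+\frac{6\rho^2}{1-\rho^2}\right)\frac{1}{t^2}+o(t^{-2}),$$ where $\Delta:=f^\ast-\frac{1}{n}\sum_{i=1}^n f^\ast_i$.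
   Context: Setting: $n$ agents are the nodes of an undirected connected graph $\mathcal{G}=(\{1,\dots,n\},\mathcal{E})$; agent $i$ has a local objective $f_i:\mathbb{R}^d\to\mathbb{R}$, and $f=\frac1n\sum_{i=1}^n f_i$. $\|\cdot\|$ is the $\ell_2$ norm. A function $h:\mathbb{R}^d\to\mathbb{R}$ is $L$-smooth if it is continuously differentiable with $\|\nabla h(x)-\nabla h(y)\|\le L\|x-y\|$ for all $x,y$; for $\mu>0$ it is $\mu$-gradient dominated if it is differentiable, has a global minimizer $x^\ast$, and $2\mu(h(x)-h(x^\ast))\le\|\nabla h(x)\|^2$ for all $x$. Consensus matrix: $W=[W_{ij}]\in\mathbb{R}^{n\times n}$ is doubly stochastic, $W_{ii}>0$ for all $i$, and for $i\ne j$, $W_{ij}>0$ if and only if $(i,j)\in\mathcal{E}$. Put $\rho:=\|W-n^{-1}\mathbf{1}_n\mathbf{1}_n^\top\|$ (spectral norm); it is known that $\rho<1$. 2-point gradient estimator: for $u>0$ and $z\in\mathbb{R}^d$, $\mathsf{G}^{(2)}_h(x;u,z):=d\cdot\frac{h(x+uz)-h(x-uz)}{2u}\,z$. Algorithm 1 (with step sizes $\eta_t>0$ and radii $u_t>0$): given deterministic initial points $x^i(0)\in\mathbb{R}^d$, for $t=1,2,\dots$ and each $i$, draw $z^i(t)$ uniformly from the unit sphere $\mathbb{S}_{d-1}\subset\mathbb{R}^d$ (all $z^i(t)$, over all $i$ and $t$, are independent), set $g^i(t)=\mathsf{G}^{(2)}_{f_i}(x^i(t-1);u_t,z^i(t))$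 and $x^i(t)=\sum_{j=1}^n W_{ij}\,(x^j(t-1)-\eta_t g^j(t))$. Notation: $\bar x(t):=\frac1n\sum_{i=1}^n x^i(t)$. *)

theory Defs
  imports "HOL-Probability.Probability"
begin

definition gradient :: "('a::real_inner \<Rightarrow> real) \<Rightarrow> 'a \<Rightarrow> 'a" where
  "gradient h x = (THE D. GDERIV h x :> D)"

lemma gradient_eqI:
  fixes h :: "'a::real_inner \<Rightarrow> real"
  assumes "GDERIV h x :> D"
  shows "gradient h x = D"
  unfolding gradient_def
proof (rule the_equality)
  show "GDERIV h x :> D" by fact
next
  fix D' assume "GDERIV h x :> D'"
  then have "(\<lambda>v. inner v D') = (\<lambda>v. inner v D)"
    using assms has_derivative_unique unfolding gderiv_def by blast
  then have "inner v D' = inner v D" for v by meson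
  then show "D' = D" by (metis vector_eq_ldot)
qed

lemma GDERIV_gradient:
  fixes h :: "'a::euclidean_space \<Rightarrow> real"
  assumes "h differentiable at x"
  shows "GDERIV h x :> gradient h x"
proof -
  obtain h' where h': "(h has_derivative h') (at x)"
    using assms by (auto simp: differentiable_def)
  interpret bounded_linear h' by (rule has_derivative_bounded_linear[OF h'])
  have "h' v = inner v (\<Sum>b\<in>Basis. h' b *\<^sub>R b)" for v
  proof -
    have "h' v = h' (\<Sum>b\<in>Basis. inner v b *\<^sub>R b)"
      by (simp add: euclidean_representation)
    also have "\<dots> = (\<Sum>b\<in>Basis. inner v b * h' b)"
      by (simp add: sum scaleR)
    also have "\<dots> = inner v (\<Sum>b\<in>Basis. h' b *\<^sub>R b)"
      by (simp add: inner_sum_right mult.commute)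
    finally show ?thesis .
  qed
  then have "GDERIV h x :> (\<Sum>b\<in>Basis. h' b *\<^sub>R b)"
    using h' unfolding gderiv_def by (metis (no_types, lifting) ext)
  then show ?thesis by (metis gradient_eqI)
qed

definition smooth_with :: "real \<Rightarrow> ('a::euclidean_space \<Rightarrow> real) \<Rightarrow> bool" where
  "smooth_with L h \<longleftrightarrow>
     (\<forall>x. h differentiable at x) \<and> continuous_on UNIV (gradient h) \<and>
     (\<forall>x y. norm (gradient h x - gradient h y) \<le> L * norm (x - y))"

definition gradient_dominated :: "real \<Rightarrow> ('a::euclidean_space \<Rightarrow> real) \<Rightarrow> bool" where
  "gradient_dominated \<mu> h \<longleftrightarrow>
     \<mu> > 0 \<and> (\<forall>x. h differentiable at x) \<and>
     (\<exists>xopt. (\<forall>x. h xopt \<le> h x) \<and>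
             (\<forall>x. 2 * \<mu> * (h x - h xopt) \<le> (norm (gradient h x))\<^sup>2))"

text \<open>The edge set of an undirected graph on all of \<open>'n\<close> is a symmetric relation.  Loops are
  neither required nor excluded, and they are irrelevant to connectedness and to consensus matrices.\<close>

definition undirected_connected :: "('n \<times> 'n) set \<Rightarrow> bool" where
  "undirected_connected E \<longleftrightarrow> sym E \<and> (\<forall>i j. (i, j) \<in> E\<^sup>*)"

definition doubly_stochastic :: "real^'n^'n \<Rightarrow> bool" where
  "doubly_stochastic W \<longleftrightarrow>
     (\<forall>i j. W $ i $ j \<ge> 0) \<and> (\<forall>i. (\<Sum>j\<in>UNIV. W $ i $ j) = 1) \<and> (\<forall>j. (\<Sum>i\<in>UNIV. W $ i $ j) = 1)"

definition consensus_matrix :: "('n \<times> 'n) set \<Rightarrow> real^'n^'n \<Rightarrow> bool" where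
  "consensus_matrix E W \<longleftrightarrow>
     doubly_stochastic W \<and> (\<forall>i. W $ i $ i > 0) \<and>
     (\<forall>i j. i \<noteq> j \<longrightarrow> (W $ i $ j > 0 \<longleftrightarrow> (i, j) \<in> E))"

definition consensus_rate :: "real^'n^'n \<Rightarrow> real" where
  "consensus_rate W = onorm ((*v) (W - (\<chi> i j. 1 / real CARD('n))))"

text \<open>The uniform distribution on the unit sphere (normalised surface measure) is obtained by
  projecting the uniform distribution on the unit ball radially: \<open>sgn x = x / norm x\<close>.\<close>

definition uniform_sphere :: "'a::euclidean_space measure" where
  "uniform_sphere = distr (uniform_measure lborel (ball 0 1)) borel sgn"

lemma prob_space_uniform_ball:
  "prob_space (uniform_measure lborel (ball (0::'a::euclidean_space) 1))"
proof (rule prob_space_uniform_measure)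
  show "emeasure lborel (ball (0::'a) 1) \<noteq> \<infinity>"
    using emeasure_lborel_ball_finite[of "0::'a" 1] by simp
  have "measure lebesgue (ball (0::'a) 1) \<noteq> 0"
    using content_ball_pos[of 1 "0::'a"] by simp
  then show "emeasure lborel (ball (0::'a) 1) \<noteq> 0"
    by (auto simp: measure_def)
qed

lemma prob_space_uniform_sphere: "prob_space (uniform_sphere :: 'a::euclidean_space measure)"
  unfolding uniform_sphere_def
  by (rule prob_space.prob_space_distr[OF prob_space_uniform_ball]) simp

lemma AE_uniform_sphere: "AE z in uniform_sphere. norm (z::'a::euclidean_space) = 1"
proof -
  have "AE x in lborel. (x::'a) \<noteq> 0"
    by (rule AE_lborel_singleton)
  then have "AE x in uniform_measure lborel (ball 0 1). (x::'a) \<noteq> 0"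
    by (intro AE_uniform_measureI) auto
  then have "AE x in uniform_measure lborel (ball 0 1). norm (sgn (x::'a)) = 1"
    by eventually_elim (simp add: norm_sgn)
  then show ?thesis
    unfolding uniform_sphere_def by (subst AE_distr_iff) auto
qed

definition grad_est2 :: "(real^'d \<Rightarrow> real) \<Rightarrow> real^'d \<Rightarrow> real \<Rightarrow> real^'d \<Rightarrow> real^'d" where
  "grad_est2 h x u z =
     (real CARD('d) * ((h (x + u *\<^sub>R z) - h (x - u *\<^sub>R z)) / (2 * u))) *\<^sub>R z"

text \<open>The iterate \<open>x\<^sup>i(t)\<close> is \<open>zo_iter W f \<eta> u x0 z t i\<close>, as a function of one realisation \<open>z\<close> of
  the directions, where \<open>z t j\<close> is the direction drawn by agent \<open>j\<close> in round \<open>t \<ge> 1\<close>.\<close>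

primrec zo_iter ::
  "real^'n^'n \<Rightarrow> ('n \<Rightarrow> real^'d \<Rightarrow> real) \<Rightarrow> (nat \<Rightarrow> real) \<Rightarrow> (nat \<Rightarrow> real) \<Rightarrow> ('n \<Rightarrow> real^'d) \<Rightarrow>
   (nat \<Rightarrow> 'n \<Rightarrow> real^'d) \<Rightarrow> nat \<Rightarrow> 'n \<Rightarrow> real^'d" where
  "zo_iter W f \<eta> u x0 z 0 = x0"
| "zo_iter W f \<eta> u x0 z (Suc t) = (\<lambda>i.
     \<Sum>j\<in>UNIV. (W $ i $ j) *\<^sub>R
       (zo_iter W f \<eta> u x0 z t j
         - \<eta> (Suc t) *\<^sub>R grad_est2 (f j) (zo_iter W f \<eta> u x0 z t j) (u (Suc t)) (z (Suc t) j)))"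

definition agent_mean :: "('n::finite \<Rightarrow> 'b::real_vector) \<Rightarrow> 'b" where
  "agent_mean y = (1 / real CARD('n)) *\<^sub>R (\<Sum>i\<in>UNIV. y i)"

end

theory Submission
  imports Defs
begin

text \<open>The proof follows two scalar sequences: the expected objective gap
\<open>\<delta> t = E[f (xbar t)] - f_star\<close> and the expected disagreement
\<open>e t = (1/n) \<Sum>i. E[\<parallel>x t i - xbar t\<parallel>\<^sup>2]\<close>. With \<open>s = t + t0\<close> they satisfy coupled linear recursions
\<open>\<delta>' \<le> (1 - 2\<alpha>/s) \<delta> + O(1/s) e + K1/s\<^sup>2\<close> and \<open>e' \<le> (1 + \<rho>\<^sup>2)/2 e + K2/s\<^sup>2\<close>, up to terms of smaller
order, where \<open>\<alpha>\<close> is the constant of the step sizes. In the first one the contraction factor falls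
short of \<open>1\<close> by \<open>2\<alpha>/s\<close> only, so \<open>\<delta>\<close> is asymptotically at most \<open>K1/((2\<alpha> - 1) s)\<close>; in the second it falls
short of \<open>1\<close> by a fixed amount, so \<open>e\<close> is asymptotically at most \<open>K2/((1 - q) s\<^sup>2)\<close> with
\<open>q = (1 + \<rho>\<^sup>2)/2\<close>. This is \<open>coupled_recursion_rates\<close>, and neither constant exceeds that of the
theorem.

The recursions come from one round of the algorithm, averaged over the fresh directions. The
gap contracts because the averaged iterate makes a gradient step on \<open>f\<close>, whose squared gradient
dominates \<open>2 \<mu> \<delta>\<close>. The disagreement contracts because \<open>W\<close> minus the averaging matrix has norm \<open>\<rho> < 1\<close>
(\<open>consensus_rate_less_1\<close>, by connectedness and the positive diagonal). The noise enters through
the local gradients. Smoothness and the lower bounds of the \<open>fi\<close> control the mean of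
\<open>\<parallel>\<nabla>fi (x i)\<parallel>\<^sup>2\<close> by \<open>4L (\<delta> + \<Delta>) + 2L\<^sup>2 e\<close> (\<open>mean_sq_gradient_le\<close>), and this is where the heterogeneity
\<open>\<Delta>\<close> comes in.

Two facts about the estimator suffice. One is the isotropy identity \<open>E[\<langle>a,z\<rangle>\<langle>b,z\<rangle>] = \<langle>a,b\<rangle>/d\<close> on
the sphere (\<open>uniform_sphere_second_moment\<close>). The other is that a central difference along a unit
vector differs from the directional derivative by at most \<open>L u/2\<close> (\<open>central_difference_error\<close>).
Multiplying this error by the component \<open>\<langle>a,z\<rangle>\<close>, whose mean square is only \<open>\<parallel>a\<parallel>\<^sup>2/d\<close>, gives a
squared bias of order \<open>d u\<^sup>2 L\<^sup>2\<close> rather than \<open>d\<^sup>2 u\<^sup>2 L\<^sup>2\<close> (\<open>grad_est2_bias\<close>), which is what makes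
the final bound linear in \<open>d\<close>.

Averages over agents are estimated agent by agent through convexity of the squared norm. Each
bound then involves a single fresh direction, independent of the past, and conditional
expectations reduce to Fubini's theorem (\<open>expectation_le_of_fresh_sample\<close>). All integrability
follows from the iterates being almost surely bounded at each time (\<open>zo_iter_bounded\<close>).\<close>

section \<open>Smooth functions and averages over agents\<close>

lemma smooth_with_GDERIV: "smooth_with L h \<Longrightarrow> GDERIV h x :> gradient h x"
  by (auto simp: smooth_with_def intro: GDERIV_gradient)

lemma smooth_with_continuous_on: "smooth_with L h \<Longrightarrow> continuous_on A h"
  by (rule continuous_at_imp_continuous_on)
    (simp add: smooth_with_def differentiable_imp_continuous_within)

lemma smooth_with_lipschitz:
  "smooth_with L h \<Longrightarrow> norm (gradient h x - gradient h y) \<le> L * norm (x - y)"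
  by (simp add: smooth_with_def)

lemma gradient_uminus:
  assumes "GDERIV h x :> D"
  shows "gradient (\<lambda>y. - h y) x = - D"
proof (rule gradient_eqI)
  show "GDERIV (\<lambda>y. - h y) x :> - D"
    using has_derivative_minus[OF assms[unfolded gderiv_def]] by (simp add: gderiv_def)
qed

lemma smooth_with_uminus:
  assumes "smooth_with L h"
  shows "smooth_with L (\<lambda>y. - h y)"
proof -
  have "gradient (\<lambda>y. - h y) = (\<lambda>x. - gradient h x)"
    using gradient_uminus[OF smooth_with_GDERIV[OF assms]] by blast
  then show ?thesis
    using assms by (auto simp: smooth_with_def norm_minus_commute intro: continuous_intros)
qed

text \<open>Along the segment from \<open>x\<close> to \<open>x + v\<close>, the excess of \<open>h\<close> over its quadratic model has derivative at
most \<open>0\<close>: the gradient changes by at most \<open>L t \<parallel>v\<parallel>\<close> after the fraction \<open>t\<close> of the way.\<close>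

lemma smooth_with_quadratic_upper:
  assumes h: "smooth_with L h"
  shows "h (x + v) \<le> h x + inner (gradient h x) v + L / 2 * (norm v)\<^sup>2"
proof -
  define \<phi> where
    "\<phi> = (\<lambda>t::real. h (x + t *\<^sub>R v) - t * inner (gradient h x) v - L * t\<^sup>2 / 2 * (norm v)\<^sup>2)"
  have "\<exists>D. DERIV \<phi> t :> D \<and> D \<le> 0" if t: "0 \<le> t" for t
  proof -
    have "(h has_derivative (\<lambda>w. inner w (gradient h (x + t *\<^sub>R v)))) (at (x + t *\<^sub>R v))"
      using smooth_with_GDERIV[OF h] by (simp add: gderiv_def)
    moreover have "((\<lambda>t. x + t *\<^sub>R v) has_derivative (\<lambda>s. s *\<^sub>R v)) (at t)"
      by (auto intro!: derivative_eq_intros)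
    ultimately have "((\<lambda>t. h (x + t *\<^sub>R v)) has_derivative
        (\<lambda>s. inner (s *\<^sub>R v) (gradient h (x + t *\<^sub>R v)))) (at t)"
      by (rule has_derivative_compose[rotated])
    then have "DERIV (\<lambda>t. h (x + t *\<^sub>R v)) t :> inner (gradient h (x + t *\<^sub>R v)) v"
      by (simp add: has_field_derivative_def inner_commute mult.commute[of _ "inner _ _"])
    then have "DERIV \<phi> t :> inner (gradient h (x + t *\<^sub>R v) - gradient h x) v - L * t * (norm v)\<^sup>2"
      unfolding \<phi>_def by (auto intro!: derivative_eq_intros simp: inner_diff_left)
    moreover have "inner (gradient h (x + t *\<^sub>R v) - gradient h x) v
        \<le> norm (gradient h (x + t *\<^sub>R v) - gradient h x) * norm v"
      by (rule norm_cauchy_schwarz)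
    moreover have "\<dots> \<le> (L * norm (t *\<^sub>R v)) * norm v"
      using smooth_with_lipschitz[OF h, of "x + t *\<^sub>R v" x] by (intro mult_right_mono) auto
    ultimately show ?thesis
      using t by (intro exI[of _ "inner (gradient h (x + t *\<^sub>R v) - gradient h x) v - L * t * (norm v)\<^sup>2"])
        (simp add: power2_eq_square mult_ac)
  qed
  then have "\<phi> 1 \<le> \<phi> 0"
    using DERIV_nonpos_imp_nonincreasing[of 0 1 \<phi>] by simp
  then show ?thesis by (simp add: \<phi>_def)
qed

lemma smooth_with_quadratic_lower:
  assumes h: "smooth_with L h"
  shows "h x + inner (gradient h x) v - L / 2 * (norm v)\<^sup>2 \<le> h (x + v)"
  using smooth_with_quadratic_upper[OF smooth_with_uminus[OF h], of x v]
  by (simp add: gradient_uminus[OF smooth_with_GDERIV[OF h]])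

text \<open>A gradient step of length \<open>1/L\<close> decreases \<open>h\<close> by at least \<open>\<parallel>\<nabla>h\<parallel>\<^sup>2/(2L)\<close>, and it cannot go below \<open>m\<close>.\<close>

lemma smooth_with_gradient_sq_le:
  assumes h: "smooth_with L h" and L: "L > 0" and lb: "\<And>y. m \<le> h y"
  shows "(norm (gradient h x))\<^sup>2 \<le> 2 * L * (h x - m)"
proof -
  have "m \<le> h x + inner (gradient h x) (- (1 / L) *\<^sub>R gradient h x)
      + L / 2 * (norm (- (1 / L) *\<^sub>R gradient h x))\<^sup>2"
    using lb smooth_with_quadratic_upper[OF h] by (rule order_trans)
  also have "\<dots> = h x - (norm (gradient h x))\<^sup>2 / (2 * L)"
    using L by (simp add: power_mult_distrib power2_norm_eq_inner[symmetric] field_simps power2_eq_square)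
  finally show ?thesis using L by (simp add: field_simps)
qed

lemma agent_mean_mono: "(\<And>i. f i \<le> g i) \<Longrightarrow> agent_mean f \<le> (agent_mean g :: real)"
  by (simp add: agent_mean_def divide_right_mono sum_mono)

lemma agent_mean_add: "agent_mean (\<lambda>i. f i + g i) = agent_mean f + agent_mean g"
  by (simp add: agent_mean_def sum.distrib scaleR_add_right)

lemma agent_mean_diff: "agent_mean (\<lambda>i. f i - g i) = agent_mean f - agent_mean g"
  by (simp add: agent_mean_def sum_subtractf scaleR_diff_right)

lemma agent_mean_const [simp]: "agent_mean (\<lambda>i::'n::finite. c) = c"
  by (simp add: agent_mean_def sum_constant_scaleR)

lemma agent_mean_cmult: "agent_mean (\<lambda>i. c * f i) = c * (agent_mean f :: real)"
  by (simp add: agent_mean_def sum_distrib_left)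

lemma agent_mean_scaleR: "agent_mean (\<lambda>i. c *\<^sub>R f i) = c *\<^sub>R agent_mean f"
  by (simp add: agent_mean_def scaleR_sum_right mult.commute)

lemma agent_mean_inner: "agent_mean (\<lambda>i. inner a (g i)) = inner a (agent_mean g)"
  by (simp add: agent_mean_def inner_sum_right)

lemma agent_mean_nonneg: "(\<And>i. 0 \<le> f i) \<Longrightarrow> 0 \<le> (agent_mean f :: real)"
  by (simp add: agent_mean_def sum_nonneg)

text \<open>The defect is the variance of \<open>g\<close> over the agents.\<close>

lemma norm_agent_mean_sq_le:
  fixes g :: "'n::finite \<Rightarrow> 'a::real_inner"
  shows "(norm (agent_mean g))\<^sup>2 \<le> agent_mean (\<lambda>i. (norm (g i))\<^sup>2)"
proof -
  let ?m = "agent_mean g"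
  have "0 \<le> agent_mean (\<lambda>i. (norm (g i - ?m))\<^sup>2)"
    by (rule agent_mean_nonneg) simp
  also have "(\<lambda>i. (norm (g i - ?m))\<^sup>2) = (\<lambda>i. ((norm (g i))\<^sup>2 - 2 * inner ?m (g i)) + (norm ?m)\<^sup>2)"
    by (simp add: power2_norm_eq_inner inner_diff inner_commute algebra_simps)
  also have "agent_mean \<dots> = agent_mean (\<lambda>i. (norm (g i))\<^sup>2) - (norm ?m)\<^sup>2"
    by (simp add: agent_mean_add agent_mean_diff agent_mean_cmult agent_mean_inner power2_norm_eq_inner)
  finally show ?thesis by simp
qed

lemma GDERIV_agent_mean:
  fixes h :: "'n::finite \<Rightarrow> 'a::real_inner \<Rightarrow> real"
  assumes "\<And>i. GDERIV (h i) x :> D i"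
  shows "GDERIV (\<lambda>y. agent_mean (\<lambda>i. h i y)) x :> agent_mean D"
proof -
  have "((\<lambda>y. \<Sum>i\<in>UNIV. h i y) has_derivative (\<lambda>v. \<Sum>i\<in>UNIV. inner v (D i))) (at x)"
    using assms by (intro has_derivative_sum) (simp add: gderiv_def)
  then have "((\<lambda>y. (1 / real CARD('n)) *\<^sub>R (\<Sum>i\<in>UNIV. h i y)) has_derivative
      (\<lambda>v. (1 / real CARD('n)) *\<^sub>R (\<Sum>i\<in>UNIV. inner v (D i)))) (at x)"
    by (rule has_derivative_scaleR_right)
  then show ?thesis
    unfolding gderiv_def agent_mean_def by (simp add: inner_sum_right)
qed

lemma smooth_with_agent_mean:
  fixes h :: "'n::finite \<Rightarrow> 'a::euclidean_space \<Rightarrow> real"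
  assumes h: "\<And>i. smooth_with L (h i)"
  shows "gradient (\<lambda>y. agent_mean (\<lambda>i. h i y)) x = agent_mean (\<lambda>i. gradient (h i) x)"
    and "smooth_with L (\<lambda>y. agent_mean (\<lambda>i. h i y))"
proof -
  have D: "GDERIV (\<lambda>y. agent_mean (\<lambda>i. h i y)) x :> agent_mean (\<lambda>i. gradient (h i) x)" for x
    by (intro GDERIV_agent_mean smooth_with_GDERIV[OF h])
  then have grad: "gradient (\<lambda>y. agent_mean (\<lambda>i. h i y)) = (\<lambda>x. agent_mean (\<lambda>i. gradient (h i) x))"
    using gradient_eqI by blast
  then show "gradient (\<lambda>y. agent_mean (\<lambda>i. h i y)) x = agent_mean (\<lambda>i. gradient (h i) x)"
    by simp
  have "norm (agent_mean (\<lambda>i. gradient (h i) x) - agent_mean (\<lambda>i. gradient (h i) y)) \<le> L * norm (x - y)" for x y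
  proof -
    have "norm (agent_mean (\<lambda>i. gradient (h i) x) - agent_mean (\<lambda>i. gradient (h i) y))
        = norm (agent_mean (\<lambda>i. gradient (h i) x - gradient (h i) y))"
      by (simp add: agent_mean_diff)
    also have "\<dots> \<le> agent_mean (\<lambda>i. norm (gradient (h i) x - gradient (h i) y))"
      by (simp add: agent_mean_def divide_right_mono norm_sum)
    also have "\<dots> \<le> agent_mean (\<lambda>i::'n. L * norm (x - y))"
      by (intro agent_mean_mono smooth_with_lipschitz[OF h])
    finally show ?thesis by simp
  qed
  moreover have "continuous_on UNIV (\<lambda>x. agent_mean (\<lambda>i. gradient (h i) x))"
    unfolding agent_mean_def using h by (auto simp: smooth_with_def intro!: continuous_intros)
  moreover have "(\<lambda>y. agent_mean (\<lambda>i. h i y)) differentiable at x" for x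
    using D by (auto simp: gderiv_def differentiable_def)
  ultimately show "smooth_with L (\<lambda>y. agent_mean (\<lambda>i. h i y))"
    by (simp add: smooth_with_def grad)
qed

section \<open>Second moments of the uniform distribution on the sphere\<close>

lemma distr_lborel_flip_coordinate:
  fixes k :: "'d::finite"
  shows "distr lborel borel (\<lambda>x::real^'d. \<chi> i. if i = k then - x $ i else x $ i) = lborel"
proof -
  define c where "c = (\<lambda>b::real^'d. if b = axis k 1 then - 1 else 1::real)"
  define T where "T = (\<lambda>x::real^'d. 0 + (\<Sum>j\<in>Basis. (c j * (x \<bullet> j)) *\<^sub>R j))"
  have "lborel = density (distr lborel borel T) (\<lambda>_. (\<Prod>j\<in>Basis. \<bar>c j\<bar>))"
    unfolding T_def by (rule lborel_affine_euclidean) (auto simp: c_def)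
  also have "(\<Prod>j\<in>Basis. \<bar>c j\<bar>) = 1"
    by (intro prod.neutral) (auto simp: c_def)
  also have "T = (\<lambda>x. \<chi> i. if i = k then - x $ i else x $ i)"
  proof
    fix x
    have "T x $ i = T x \<bullet> axis i 1" for i by (simp add: inner_axis)
    also have "T x \<bullet> axis i 1 = c (axis i 1) * (x \<bullet> axis i 1)" for i
      unfolding T_def by (simp add: axis_in_Basis_iff)
    finally show "T x = (\<chi> i. if i = k then - x $ i else x $ i)"
      by (simp add: vec_eq_iff[of "T x"] c_def inner_axis axis_eq_axis)
  qed
  finally show ?thesis by (simp add: density_1)
qed

text \<open>Reflections and permutations of coordinates already force isotropic second moments, and for
these maps invariance of Lebesgue measure is visible on boxes.\<close>

lemma distr_lborel_permute_coordinates: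
  fixes \<pi> :: "'d::finite \<Rightarrow> 'd"
  assumes \<pi>: "bij \<pi>"
  shows "distr lborel borel (\<lambda>x::real^'d. \<chi> i. x $ \<pi> i) = lborel"
proof (rule lborel_eqI[symmetric])
  fix l u :: "real^'d" assume lu: "\<And>b. b \<in> Basis \<Longrightarrow> l \<bullet> b \<le> u \<bullet> b"
  let ?\<sigma> = "inv \<pi>"
  have \<sigma>: "bij ?\<sigma>" and cancel: "\<And>i. \<pi> (?\<sigma> i) = i" "\<And>i. ?\<sigma> (\<pi> i) = i"
    using \<pi> by (auto simp: bij_imp_bij_inv bij_is_surj surj_f_inv_f bij_is_inj inv_f_f)
  have "l $ i \<le> u $ i" for i
    using lu[of "axis i 1"] by (simp add: inner_axis axis_in_Basis_iff)
  then have lu': "l $ (?\<sigma> i) \<le> u $ (?\<sigma> i)" for i by simp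
  have basis_prod: "(\<Prod>b\<in>Basis. v \<bullet> b) = (\<Prod>i\<in>UNIV. v $ i)" for v :: "real^'d"
  proof -
    have B: "(Basis :: (real^'d) set) = (\<lambda>i. axis i 1) ` UNIV"
      by (auto simp: Basis_vec_def)
    show ?thesis
      unfolding B by (subst prod.reindex) (auto simp: inj_on_def axis_eq_axis inner_axis)
  qed
  have "(\<lambda>x::real^'d. \<chi> i. x $ \<pi> i) \<in> borel_measurable borel"
    by (intro borel_measurable_continuous_onI continuous_intros)
  then have "emeasure (distr lborel borel (\<lambda>x::real^'d. \<chi> i. x $ \<pi> i)) (box l u)
      = emeasure lborel ((\<lambda>x::real^'d. \<chi> i. x $ \<pi> i) -` box l u)"
    by (subst emeasure_distr) auto
  also have "(\<lambda>x::real^'d. \<chi> i. x $ \<pi> i) -` box l u = box (\<chi> i. l $ ?\<sigma> i) (\<chi> i. u $ ?\<sigma> i)"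
    by (auto simp: mem_box_cart) (metis cancel)+
  also have "emeasure lborel \<dots> = (\<Prod>b\<in>Basis. ((\<chi> i. u $ ?\<sigma> i) - (\<chi> i. l $ ?\<sigma> i)) \<bullet> b)"
    using lu' by (intro emeasure_lborel_box) (auto simp: Basis_vec_def inner_axis)
  also have "(\<Prod>b\<in>Basis. ((\<chi> i. u $ ?\<sigma> i) - (\<chi> i. l $ ?\<sigma> i)) \<bullet> b) = (\<Prod>i\<in>UNIV. (u - l) $ ?\<sigma> i)"
    by (simp add: basis_prod)
  also have "\<dots> = (\<Prod>i\<in>UNIV. (u - l) $ i)"
    using prod.reindex_bij_betw[OF \<sigma>, of "\<lambda>i. (u - l) $ i"] by simp
  also have "\<dots> = (\<Prod>b\<in>Basis. (u - l) \<bullet> b)"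
    by (simp add: basis_prod)
  finally show "emeasure (distr lborel borel (\<lambda>x::real^'d. \<chi> i. x $ \<pi> i)) (box l u)
      = ennreal (\<Prod>b\<in>Basis. (u - l) \<bullet> b)" .
qed simp

text \<open>A linear isometry preserves the unit ball and commutes with the radial projection \<open>sgn\<close>, so
invariance of Lebesgue measure passes to the sphere.\<close>

lemma distr_uniform_sphere_isometry:
  fixes T :: "'a::euclidean_space \<Rightarrow> 'a"
  assumes lin: "linear T" and iso: "\<And>x. norm (T x) = norm x"
    and inv: "distr lborel borel T = lborel"
  shows "distr uniform_sphere borel T = uniform_sphere"
proof -
  have T[measurable]: "T \<in> borel_measurable borel"
    using lin by (intro borel_measurable_continuous_onI linear_continuous_on linear_conv_bounded_linear[THEN iffD1])
  let ?U = "uniform_measure lborel (ball (0::'a) 1)"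
  have "distr ?U borel T = ?U"
  proof (rule measure_eqI)
    fix A assume "A \<in> sets (distr ?U borel T)"
    then have A[measurable]: "A \<in> sets borel" by simp
    have "T -` A \<inter> space borel \<in> sets borel" by (rule measurable_sets[OF T A])
    then have TA: "T -` A \<in> sets borel" by simp
    have "emeasure (distr ?U borel T) A = emeasure ?U (T -` A)"
      by (subst emeasure_distr) auto
    also have "\<dots> = emeasure lborel (ball 0 1 \<inter> T -` A) / emeasure lborel (ball (0::'a) 1)"
      using TA by (subst emeasure_uniform_measure) auto
    also have "ball 0 1 \<inter> T -` A = T -` (ball 0 1 \<inter> A)"
      by (auto simp: iso)
    also have "emeasure lborel (T -` (ball 0 1 \<inter> A)) = emeasure (distr lborel borel T) (ball 0 1 \<inter> A)"
      by (subst emeasure_distr) auto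
    also have "\<dots> = emeasure lborel (ball 0 1 \<inter> A)" by (simp add: inv)
    finally show "emeasure (distr ?U borel T) A = emeasure ?U A"
      by (subst (asm) emeasure_uniform_measure[symmetric]) auto
  qed simp
  then have "uniform_sphere = distr (distr ?U borel T) borel sgn"
    by (simp add: uniform_sphere_def)
  also have "\<dots> = distr ?U borel (\<lambda>x. sgn (T x))"
    by (subst distr_distr) (auto simp: comp_def)
  also have "(\<lambda>x. sgn (T x)) = (\<lambda>x. T (sgn x))"
    by (simp add: sgn_div_norm iso linear_scale[OF lin])
  also have "distr ?U borel (\<lambda>x. T (sgn x)) = distr uniform_sphere borel T"
    unfolding uniform_sphere_def by (subst distr_distr) (auto simp: comp_def)
  finally show ?thesis by simp
qed

lemma sets_uniform_sphere [simp, measurable_cong]: "sets uniform_sphere = sets borel"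
  and space_uniform_sphere [simp]: "space uniform_sphere = UNIV"
  by (simp_all add: uniform_sphere_def)

lemma integrable_uniform_sphere:
  fixes F :: "'a::euclidean_space \<Rightarrow> real"
  assumes F: "F \<in> borel_measurable borel" and bound: "\<And>z. norm z = 1 \<Longrightarrow> \<bar>F z\<bar> \<le> B"
  shows "integrable uniform_sphere F"
proof -
  interpret prob_space "uniform_sphere :: 'a measure" by (rule prob_space_uniform_sphere)
  show ?thesis
    using F AE_uniform_sphere bound
    by (intro integrable_const_bound[where B=B]) (auto elim: eventually_mono)
qed

lemma integrable_inner_mult_uniform_sphere:
  "integrable uniform_sphere (\<lambda>z::'a::euclidean_space. (a \<bullet> z) * (b \<bullet> z))"
proof (rule integrable_uniform_sphere)
  fix z :: 'a assume z: "norm z = 1"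
  have "\<bar>a \<bullet> z\<bar> \<le> norm a" "\<bar>b \<bullet> z\<bar> \<le> norm b"
    using Cauchy_Schwarz_ineq2[of a z] Cauchy_Schwarz_ineq2[of b z] z by auto
  then show "\<bar>(a \<bullet> z) * (b \<bullet> z)\<bar> \<le> norm a * norm b"
    by (simp add: abs_mult mult_mono)
qed simp

text \<open>Reflecting coordinate \<open>i\<close> flips the sign of a mixed moment, so it vanishes. Swapping coordinates
shows that all pure moments agree, and they add up to \<open>1\<close> because \<open>\<parallel>z\<parallel> = 1\<close>.\<close>

lemma uniform_sphere_component_moments:
  fixes i j :: "'d::finite"
  shows "(\<integral>z. z $ i * z $ j \<partial>(uniform_sphere :: (real^'d) measure))
    = (if i = j then 1 / real CARD('d) else 0)"
proof -
  let ?S = "uniform_sphere :: (real^'d) measure"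
  interpret prob_space ?S by (rule prob_space_uniform_sphere)
  have int: "integrable ?S (\<lambda>z. z $ i * z $ j)" for i j
    using integrable_inner_mult_uniform_sphere[of "axis i 1 :: real^'d" "axis j 1"]
    by (simp add: inner_axis' )
  have invariant: "(\<integral>z. z $ i * z $ j \<partial>?S) = (\<integral>z. T z $ i * T z $ j \<partial>?S)"
    if "linear T" "\<And>x. norm (T x) = norm x" "distr lborel borel T = lborel" for T i j
  proof -
    have [measurable]: "T \<in> borel_measurable borel"
      using that(1) by (intro borel_measurable_continuous_onI linear_continuous_on linear_conv_bounded_linear[THEN iffD1])
    have "(\<integral>z. z $ i * z $ j \<partial>?S) = (\<integral>z. z $ i * z $ j \<partial>(distr ?S borel T))"
      by (simp add: distr_uniform_sphere_isometry[OF that])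
    also have "\<dots> = (\<integral>z. T z $ i * T z $ j \<partial>?S)"
      by (subst integral_distr) auto
    finally show ?thesis .
  qed
  have off: "(\<integral>z. z $ i * z $ j \<partial>?S) = 0" if "i \<noteq> j" for i j
  proof -
    let ?T = "\<lambda>x::real^'d. \<chi> k. if k = i then - x $ k else x $ k"
    have "linear ?T" by (rule linearI) (auto simp: vec_eq_iff)
    moreover have "norm (?T x) = norm x" for x
      unfolding norm_vec_def by (intro arg_cong[where f="\<lambda>g. L2_set g UNIV"] ext) auto
    ultimately have "(\<integral>z. z $ i * z $ j \<partial>?S) = (\<integral>z. ?T z $ i * ?T z $ j \<partial>?S)"
      by (rule invariant) (rule distr_lborel_flip_coordinate)
    also have "\<dots> = - (\<integral>z. z $ i * z $ j \<partial>?S)"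
      using that by simp
    finally show ?thesis by simp
  qed
  have diag: "(\<integral>z. z $ i * z $ i \<partial>?S) = (\<integral>z. z $ j * z $ j \<partial>?S)" for i j
  proof -
    let ?p = "Transposition.transpose i j"
    let ?T = "\<lambda>x::real^'d. \<chi> k. x $ ?p k"
    have "linear ?T" by (rule linearI) (auto simp: vec_eq_iff)
    moreover have "norm (?T x) = norm x" for x
    proof -
      have "(\<Sum>k\<in>UNIV. (norm (x $ ?p k))\<^sup>2) = (\<Sum>k\<in>UNIV. (norm (x $ k))\<^sup>2)"
        using sum.reindex_bij_betw[OF bij_transpose, of "\<lambda>k. (norm (x $ k))\<^sup>2"] by simp
      then show ?thesis by (simp add: norm_vec_def L2_set_def)
    qed
    moreover have "distr lborel borel ?T = lborel"
      by (intro distr_lborel_permute_coordinates bij_transpose)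
    ultimately have "(\<integral>z. z $ i * z $ i \<partial>?S) = (\<integral>z. ?T z $ i * ?T z $ i \<partial>?S)"
      by (rule invariant)
    then show ?thesis by simp
  qed
  have "real CARD('d) * (\<integral>z. z $ i * z $ i \<partial>?S) = (\<Sum>k\<in>UNIV. (\<integral>z. z $ k * z $ k \<partial>?S))"
    by (subst diag[of _ i]) simp
  also have "\<dots> = (\<integral>z. (\<Sum>k\<in>UNIV. z $ k * z $ k) \<partial>?S)"
    using int by simp
  also have "\<dots> = (\<integral>z. 1 \<partial>?S)"
  proof (rule integral_cong_AE)
    have "AE z::real^'d in uniform_sphere. norm z = 1" by (rule AE_uniform_sphere)
    then show "AE z::real^'d in uniform_sphere. (\<Sum>k\<in>UNIV. z $ k * z $ k) = 1"
      by eventually_elim (simp add: norm_eq_1 inner_vec_def)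
  qed auto
  also have "\<dots> = 1" using prob_space by simp
  finally show ?thesis
    using off by (auto simp: field_simps)
qed

lemma uniform_sphere_second_moment:
  fixes a b :: "real^'d::finite"
  shows "(\<integral>z. (a \<bullet> z) * (b \<bullet> z) \<partial>uniform_sphere) = (a \<bullet> b) / real CARD('d)"
proof -
  have int: "integrable uniform_sphere (\<lambda>z::real^'d. z $ i * z $ j)" for i j
    using integrable_inner_mult_uniform_sphere[of "axis i 1 :: real^'d" "axis j 1"]
    by (simp add: inner_axis' )
  have "(\<integral>z. (a \<bullet> z) * (b \<bullet> z) \<partial>uniform_sphere)
      = (\<integral>z. (\<Sum>i\<in>UNIV. \<Sum>j\<in>UNIV. a $ i * b $ j * (z $ i * z $ j)) \<partial>uniform_sphere)"
    by (simp add: inner_vec_def sum_product mult_ac)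
  also have "\<dots> = (\<Sum>i\<in>UNIV. \<Sum>j\<in>UNIV. a $ i * b $ j * (if i = j then 1 / real CARD('d) else 0))"
    using int by (simp add: uniform_sphere_component_moments)
  also have "\<dots> = (a \<bullet> b) / real CARD('d)"
    by (simp add: inner_vec_def sum_divide_distrib if_distrib cong: if_cong)
  finally show ?thesis .
qed

section \<open>Bias and second moment of the two-point estimator\<close>

text \<open>The quadratic models at \<open>x + u z\<close> and \<open>x - u z\<close> share their constant terms, which cancel in the
difference, while the linear terms add up.\<close>

lemma central_difference_error:
  assumes h: "smooth_with L h" and u: "u > 0"
  shows "\<bar>(h (x + u *\<^sub>R z) - h (x - u *\<^sub>R z)) / (2 * u) - gradient h x \<bullet> z\<bar> \<le> L * u / 2 * (norm z)\<^sup>2"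
proof -
  have "\<bar>(h (x + u *\<^sub>R z) - h (x - u *\<^sub>R z)) - 2 * u * (gradient h x \<bullet> z)\<bar> \<le> L * u\<^sup>2 * (norm z)\<^sup>2"
    using smooth_with_quadratic_upper[OF h, of x "u *\<^sub>R z"] smooth_with_quadratic_lower[OF h, of x "u *\<^sub>R z"]
      smooth_with_quadratic_upper[OF h, of x "- (u *\<^sub>R z)"] smooth_with_quadratic_lower[OF h, of x "- (u *\<^sub>R z)"] u
    by (simp add: power_mult_distrib abs_le_iff)
  then have "\<bar>(h (x + u *\<^sub>R z) - h (x - u *\<^sub>R z)) - 2 * u * (gradient h x \<bullet> z)\<bar> / (2 * u)
      \<le> L * u\<^sup>2 * (norm z)\<^sup>2 / (2 * u)"
    using u by (intro divide_right_mono) auto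
  moreover have "\<bar>(h (x + u *\<^sub>R z) - h (x - u *\<^sub>R z)) - 2 * u * (gradient h x \<bullet> z)\<bar> / (2 * u)
      = \<bar>((h (x + u *\<^sub>R z) - h (x - u *\<^sub>R z)) - 2 * u * (gradient h x \<bullet> z)) / (2 * u)\<bar>"
    using u by simp
  moreover have "((h (x + u *\<^sub>R z) - h (x - u *\<^sub>R z)) - 2 * u * (gradient h x \<bullet> z)) / (2 * u)
      = (h (x + u *\<^sub>R z) - h (x - u *\<^sub>R z)) / (2 * u) - gradient h x \<bullet> z"
    using u by (simp add: diff_divide_distrib)
  moreover have "L * u\<^sup>2 * (norm z)\<^sup>2 / (2 * u) = L * u / 2 * (norm z)\<^sup>2"
    using u by (simp add: power2_eq_square)
  ultimately show ?thesis by metis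
qed

lemma grad_est2_measurable:
  assumes h: "smooth_with L h"
    and f: "f \<in> borel_measurable M" and g: "g \<in> borel_measurable M"
  shows "(\<lambda>w. grad_est2 h (f w) u (g w)) \<in> borel_measurable M"
proof -
  have [measurable]: "h \<in> borel_measurable borel"
    by (rule borel_measurable_continuous_onI[OF smooth_with_continuous_on[OF h]])
  note [measurable] = f g
  show ?thesis unfolding grad_est2_def by measurable
qed

lemma norm_grad_est2_le:
  fixes h :: "real^'d::finite \<Rightarrow> real"
  assumes h: "smooth_with L h" and u: "u > 0" and z: "norm z = 1"
  shows "norm (grad_est2 h x u z) \<le> real CARD('d) * (norm (gradient h x) + L * u / 2)"
proof -
  define q where "q = (h (x + u *\<^sub>R z) - h (x - u *\<^sub>R z)) / (2 * u)"
  have "\<bar>gradient h x \<bullet> z\<bar> \<le> norm (gradient h x)"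
    using Cauchy_Schwarz_ineq2[of "gradient h x" z] z by simp
  moreover have "\<bar>q - gradient h x \<bullet> z\<bar> \<le> L * u / 2"
    using central_difference_error[OF h u, of x z] z unfolding q_def[symmetric] by simp
  ultimately have "\<bar>q\<bar> \<le> norm (gradient h x) + L * u / 2"
    by linarith
  then show ?thesis
    by (simp add: grad_est2_def z abs_mult q_def[symmetric])
qed

lemma integrable_grad_est2:
  fixes h :: "real^'d::finite \<Rightarrow> real"
  assumes h: "smooth_with L h" and u: "u > 0"
  shows "integrable uniform_sphere (\<lambda>z. a \<bullet> grad_est2 h x u z)"
    and "integrable uniform_sphere (\<lambda>z. (norm (grad_est2 h x u z))\<^sup>2)"
proof -
  let ?B = "real CARD('d) * (norm (gradient h x) + L * u / 2)"
  have [measurable]: "(\<lambda>z. grad_est2 h x u z) \<in> borel_measurable borel"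
    by (rule grad_est2_measurable[OF h]) auto
  show "integrable uniform_sphere (\<lambda>z. a \<bullet> grad_est2 h x u z)"
  proof (rule integrable_uniform_sphere)
    fix z :: "real^'d" assume z: "norm z = 1"
    have "\<bar>a \<bullet> grad_est2 h x u z\<bar> \<le> norm a * norm (grad_est2 h x u z)"
      by (rule Cauchy_Schwarz_ineq2)
    also have "\<dots> \<le> norm a * ?B"
      by (intro mult_left_mono norm_grad_est2_le[OF h u z]) simp
    finally show "\<bar>a \<bullet> grad_est2 h x u z\<bar> \<le> norm a * ?B" .
  qed simp
  show "integrable uniform_sphere (\<lambda>z. (norm (grad_est2 h x u z))\<^sup>2)"
  proof (rule integrable_uniform_sphere)
    fix z :: "real^'d" assume z: "norm z = 1"
    show "\<bar>(norm (grad_est2 h x u z))\<^sup>2\<bar> \<le> ?B\<^sup>2"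
      using power_mono[OF norm_grad_est2_le[OF h u z], where n=2] by simp
  qed simp
qed

lemma integral_sphere_quadratic:
  fixes a b a' b' :: "real^'d::finite"
  shows "(\<integral>z. \<alpha> * ((a \<bullet> z) * (b \<bullet> z)) + \<beta> * ((a' \<bullet> z) * (b' \<bullet> z)) + \<gamma> \<partial>uniform_sphere)
    = \<alpha> * ((a \<bullet> b) / real CARD('d)) + \<beta> * ((a' \<bullet> b') / real CARD('d)) + \<gamma>"
proof -
  interpret prob_space "uniform_sphere :: (real^'d) measure" by (rule prob_space_uniform_sphere)
  have int: "integrable uniform_sphere (\<lambda>z. \<kappa> * ((v \<bullet> z) * (w \<bullet> z)))" for \<kappa> and v w :: "real^'d"
    by (intro integrable_mult_right integrable_inner_mult_uniform_sphere)
  have "(\<integral>z. \<alpha> * ((a \<bullet> z) * (b \<bullet> z)) + \<beta> * ((a' \<bullet> z) * (b' \<bullet> z)) + \<gamma> \<partial>uniform_sphere)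
      = (\<integral>z. \<alpha> * ((a \<bullet> z) * (b \<bullet> z)) \<partial>uniform_sphere) + (\<integral>z. \<beta> * ((a' \<bullet> z) * (b' \<bullet> z)) \<partial>uniform_sphere)
        + (\<integral>z. \<gamma> \<partial>(uniform_sphere :: (real^'d) measure))"
    by (subst Bochner_Integration.integral_add Bochner_Integration.integrable_add,
        (intro Bochner_Integration.integrable_add int integrable_const)+)+ simp
  then show ?thesis
    using prob_space by (simp only: integral_mult_right_zero uniform_sphere_second_moment lebesgue_integral_const scaleR_one space_uniform_sphere)
qed

text \<open>With \<open>e\<close> the central-difference error, \<open>\<langle>a, grad_est2\<rangle>\<close> deviates from its linear model by
\<open>d e \<langle>a,z\<rangle>\<close>. Splitting this product by Young's inequality with a free weight \<open>c\<close> keeps the small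
second moment \<open>\<parallel>a\<parallel>\<^sup>2/d\<close> of \<open>\<langle>a,z\<rangle>\<close>; bounding \<open>\<langle>a,z\<rangle>\<close> by \<open>\<parallel>a\<parallel>\<close> instead would cost a factor \<open>d\<close>.\<close>

lemma grad_est2_bias:
  fixes h :: "real^'d::finite \<Rightarrow> real"
  assumes h: "smooth_with L h" and u: "u > 0" and c: "c > 0"
  shows "(\<integral>z. - (a \<bullet> grad_est2 h x u z) \<partial>uniform_sphere)
    \<le> - (a \<bullet> gradient h x) + c / 2 * (norm a)\<^sup>2 + real CARD('d) * u\<^sup>2 * L\<^sup>2 / (8 * c)"
proof -
  let ?d = "real CARD('d)" and ?g = "gradient h x"
  interpret prob_space "uniform_sphere :: (real^'d) measure" by (rule prob_space_uniform_sphere)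
  let ?R = "\<lambda>z. - ?d * ((?g \<bullet> z) * (a \<bullet> z)) + (?d * (c / 2)) * ((a \<bullet> z) * (a \<bullet> z)) + ?d * (u\<^sup>2 * L\<^sup>2 / (8 * c))"
  note int = integrable_inner_mult_uniform_sphere
  have "(\<integral>z. - (a \<bullet> grad_est2 h x u z) \<partial>uniform_sphere) \<le> (\<integral>z. ?R z \<partial>uniform_sphere)"
  proof (rule integral_mono_AE)
    show "integrable uniform_sphere (\<lambda>z. - (a \<bullet> grad_est2 h x u z))"
      using integrable_grad_est2(1)[OF h u] by simp
    show "integrable uniform_sphere ?R"
      using int by (intro Bochner_Integration.integrable_add integrable_mult_right) auto
    have "AE z::real^'d in uniform_sphere. norm z = 1" by (rule AE_uniform_sphere)
    then show "AE z in uniform_sphere. - (a \<bullet> grad_est2 h x u z) \<le> ?R z"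
    proof eventually_elim
      fix z :: "real^'d" assume z: "norm z = 1"
      define q where "q = (h (x + u *\<^sub>R z) - h (x - u *\<^sub>R z)) / (2 * u)"
      define e where "e = q - ?g \<bullet> z"
      have e: "\<bar>e\<bar> \<le> L * u / 2"
        using central_difference_error[OF h u, of x z] z by (simp add: e_def q_def)
      then have "\<bar>e\<bar>\<^sup>2 \<le> (L * u / 2)\<^sup>2" by (intro power_mono) auto
      then have e2: "e\<^sup>2 / (2 * c) \<le> u\<^sup>2 * L\<^sup>2 / (8 * c)"
        using c by (simp add: field_simps power2_eq_square)
      have "0 \<le> (c * (a \<bullet> z) + e)\<^sup>2 / (2 * c)" using c by simp
      also have "\<dots> = c / 2 * ((a \<bullet> z) * (a \<bullet> z)) + e * (a \<bullet> z) + e\<^sup>2 / (2 * c)"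
        using c by (simp add: field_simps power2_eq_square)
      finally have "- (e * (a \<bullet> z)) \<le> c / 2 * ((a \<bullet> z) * (a \<bullet> z)) + u\<^sup>2 * L\<^sup>2 / (8 * c)"
        using e2 by simp
      then have "?d * (- (e * (a \<bullet> z))) \<le> ?d * (c / 2 * ((a \<bullet> z) * (a \<bullet> z)) + u\<^sup>2 * L\<^sup>2 / (8 * c))"
        by (intro mult_left_mono) auto
      moreover have "a \<bullet> grad_est2 h x u z = ?d * (?g \<bullet> z + e) * (a \<bullet> z)"
        by (simp add: grad_est2_def e_def q_def)
      ultimately show "- (a \<bullet> grad_est2 h x u z) \<le> ?R z"
        by (simp add: algebra_simps)
    qed
  qed
  also have "(\<integral>z. ?R z \<partial>uniform_sphere)
      = - ?d * ((?g \<bullet> a) / ?d) + (?d * (c / 2)) * ((a \<bullet> a) / ?d) + ?d * (u\<^sup>2 * L\<^sup>2 / (8 * c))"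
    by (rule integral_sphere_quadratic)
  also have "\<dots> = - (a \<bullet> ?g) + c / 2 * (norm a)\<^sup>2 + ?d * u\<^sup>2 * L\<^sup>2 / (8 * c)"
    by (simp add: power2_norm_eq_inner inner_commute)
  finally show ?thesis .
qed

text \<open>The factor \<open>4/3\<close> is the weight of the main term in \<open>(p + e)\<^sup>2 \<le> (4/3) p\<^sup>2 + 4 e\<^sup>2\<close>; the coefficient
\<open>4\<close> cancels the square of the \<open>1/2\<close> in the error \<open>L u/2\<close>.\<close>

lemma grad_est2_second_moment:
  fixes h :: "real^'d::finite \<Rightarrow> real"
  assumes h: "smooth_with L h" and u: "u > 0"
  shows "(\<integral>z. (norm (grad_est2 h x u z))\<^sup>2 \<partial>uniform_sphere)
    \<le> 4 * real CARD('d) / 3 * (norm (gradient h x))\<^sup>2 + u\<^sup>2 * L\<^sup>2 * (real CARD('d))\<^sup>2"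
proof -
  let ?d = "real CARD('d)" and ?g = "gradient h x"
  interpret prob_space "uniform_sphere :: (real^'d) measure" by (rule prob_space_uniform_sphere)
  let ?R = "\<lambda>z. (4 / 3 * ?d\<^sup>2) * ((?g \<bullet> z) * (?g \<bullet> z)) + ?d\<^sup>2 * (u\<^sup>2 * L\<^sup>2)"
  note int = integrable_inner_mult_uniform_sphere
  have "(\<integral>z. (norm (grad_est2 h x u z))\<^sup>2 \<partial>uniform_sphere) \<le> (\<integral>z. ?R z \<partial>uniform_sphere)"
  proof (rule integral_mono_AE)
    show "integrable uniform_sphere (\<lambda>z. (norm (grad_est2 h x u z))\<^sup>2)"
      by (rule integrable_grad_est2(2)[OF h u])
    show "integrable uniform_sphere ?R"
      using int by (intro Bochner_Integration.integrable_add integrable_mult_right) auto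
    have "AE z::real^'d in uniform_sphere. norm z = 1" by (rule AE_uniform_sphere)
    then show "AE z in uniform_sphere. (norm (grad_est2 h x u z))\<^sup>2 \<le> ?R z"
    proof eventually_elim
      fix z :: "real^'d" assume z: "norm z = 1"
      define q where "q = (h (x + u *\<^sub>R z) - h (x - u *\<^sub>R z)) / (2 * u)"
      define e where "e = q - ?g \<bullet> z"
      have e: "\<bar>e\<bar> \<le> L * u / 2"
        using central_difference_error[OF h u, of x z] z by (simp add: e_def q_def)
      then have "\<bar>e\<bar>\<^sup>2 \<le> (L * u / 2)\<^sup>2" by (intro power_mono) auto
      then have e2: "4 * e\<^sup>2 \<le> u\<^sup>2 * L\<^sup>2"
        by (simp add: field_simps power2_eq_square)
      have "0 \<le> ((?g \<bullet> z) - 3 * e)\<^sup>2 / 3" by simp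
      also have "\<dots> = 4 / 3 * ((?g \<bullet> z) * (?g \<bullet> z)) + 4 * e\<^sup>2 - (?g \<bullet> z + e)\<^sup>2"
        by (simp add: field_simps power2_eq_square)
      finally have "(?g \<bullet> z + e)\<^sup>2 \<le> 4 / 3 * ((?g \<bullet> z) * (?g \<bullet> z)) + u\<^sup>2 * L\<^sup>2"
        using e2 by simp
      then have "?d\<^sup>2 * (?g \<bullet> z + e)\<^sup>2 \<le> ?d\<^sup>2 * (4 / 3 * ((?g \<bullet> z) * (?g \<bullet> z)) + u\<^sup>2 * L\<^sup>2)"
        by (intro mult_left_mono) auto
      moreover have "(norm (grad_est2 h x u z))\<^sup>2 = ?d\<^sup>2 * (?g \<bullet> z + e)\<^sup>2"
        by (simp add: grad_est2_def e_def q_def[symmetric] z power_mult_distrib)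
      ultimately show "(norm (grad_est2 h x u z))\<^sup>2 \<le> ?R z"
        by (simp add: algebra_simps)
    qed
  qed
  also have "(\<integral>z. ?R z \<partial>uniform_sphere) = (4 / 3 * ?d\<^sup>2) * ((?g \<bullet> ?g) / ?d) + ?d\<^sup>2 * (u\<^sup>2 * L\<^sup>2)"
    using integral_sphere_quadratic[of "4 / 3 * ?d\<^sup>2" ?g ?g 0 0 0 "?d\<^sup>2 * (u\<^sup>2 * L\<^sup>2)"]
    by (simp only: mult_zero_left add_0_right)
  also have "\<dots> = 4 * ?d / 3 * (norm ?g)\<^sup>2 + u\<^sup>2 * L\<^sup>2 * ?d\<^sup>2"
    by (simp add: power2_norm_eq_inner) (simp add: power2_eq_square)
  finally show ?thesis .
qed

section \<open>Contraction of disagreement by the consensus matrix\<close>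

lemma doubly_stochasticD:
  assumes "doubly_stochastic W"
  shows "0 \<le> W $ i $ j" "(\<Sum>j\<in>UNIV. W $ i $ j) = 1" "(\<Sum>i\<in>UNIV. W $ i $ j) = 1"
  using assms by (auto simp: doubly_stochastic_def)

lemma consensus_rate_nonneg: "0 \<le> consensus_rate W"
  unfolding consensus_rate_def by (intro onorm_pos_le matrix_vector_mul_bounded_linear)

text \<open>Each row of \<open>W\<close> is a probability vector, so squaring an average loses exactly a variance. Unit
column sums turn the sum of the averaged squares back into the plain sum of squares.\<close>

lemma doubly_stochastic_energy:
  fixes W :: "real^'n^'n" and w :: "'n::finite \<Rightarrow> real"
  assumes W: "doubly_stochastic W"
  shows "(\<Sum>i\<in>UNIV. (\<Sum>j\<in>UNIV. W $ i $ j * w j)\<^sup>2) = (\<Sum>j\<in>UNIV. (w j)\<^sup>2)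
    - (\<Sum>i\<in>UNIV. \<Sum>j\<in>UNIV. W $ i $ j * (w j - (\<Sum>k\<in>UNIV. W $ i $ k * w k))\<^sup>2)"
proof -
  note D = doubly_stochasticD[OF W]
  define s where "s i = (\<Sum>k\<in>UNIV. W $ i $ k * w k)" for i
  have row: "(\<Sum>j\<in>UNIV. W $ i $ j * (w j - s i)\<^sup>2) = (\<Sum>j\<in>UNIV. W $ i $ j * (w j)\<^sup>2) - (s i)\<^sup>2" for i
  proof -
    have "(\<Sum>j\<in>UNIV. W $ i $ j * (w j - s i)\<^sup>2)
        = (\<Sum>j\<in>UNIV. W $ i $ j * (w j)\<^sup>2 - (2 * s i) * (W $ i $ j * w j) + (s i)\<^sup>2 * W $ i $ j)"
      by (intro sum.cong) (auto simp: power2_eq_square algebra_simps)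
    also have "\<dots> = (\<Sum>j\<in>UNIV. W $ i $ j * (w j)\<^sup>2) - (2 * s i) * s i + (s i)\<^sup>2 * 1"
      by (simp only: sum.distrib sum_subtractf sum_distrib_left[symmetric] s_def[symmetric] D(2))
    finally show ?thesis by (simp add: power2_eq_square)
  qed
  have "(\<Sum>i\<in>UNIV. \<Sum>j\<in>UNIV. W $ i $ j * (w j)\<^sup>2) = (\<Sum>j\<in>UNIV. \<Sum>i\<in>UNIV. W $ i $ j * (w j)\<^sup>2)"
    by (rule sum.swap)
  also have "\<dots> = (\<Sum>j\<in>UNIV. (w j)\<^sup>2)"
    by (simp add: sum_distrib_right[symmetric] D(3))
  finally show ?thesis
    by (simp add: s_def[symmetric] row sum_subtractf)
qed

text \<open>No variance in row \<open>i\<close> means that \<open>w\<close> takes one value on the neighbours of \<open>i\<close>, and by the positive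
diagonal that value is \<open>w i\<close>. Connectedness spreads it over the whole graph.\<close>

lemma consensus_deviation_eq_0:
  fixes W :: "real^'n^'n" and w :: "'n::finite \<Rightarrow> real"
  assumes G: "undirected_connected E" and W: "consensus_matrix E W"
    and eq: "(\<Sum>i\<in>UNIV. \<Sum>j\<in>UNIV. W $ i $ j * (w j - (\<Sum>k\<in>UNIV. W $ i $ k * w k))\<^sup>2) = 0"
  shows "w i = w j"
proof -
  define s where "s i = (\<Sum>k\<in>UNIV. W $ i $ k * w k)" for i
  have D: "doubly_stochastic W" and diag: "\<And>i. W $ i $ i > 0"
    and edge: "\<And>i j. (i, j) \<in> E \<Longrightarrow> i \<noteq> j \<Longrightarrow> W $ i $ j > 0"
    using W by (auto simp: consensus_matrix_def)
  have nn: "0 \<le> W $ i $ j * (w j - s i)\<^sup>2" for i j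
    using doubly_stochasticD(1)[OF D] by simp
  have "(\<Sum>j\<in>UNIV. W $ i $ j * (w j - s i)\<^sup>2) = 0" for i
    using eq nn unfolding s_def[symmetric] by (subst (asm) sum_nonneg_eq_0_iff) (auto intro: sum_nonneg)
  then have "W $ i $ j * (w j - s i)\<^sup>2 = 0" for i j
    using nn by (subst (asm) sum_nonneg_eq_0_iff) auto
  then have pos: "W $ i $ j > 0 \<Longrightarrow> w j = s i" for i j
    by (metis less_irrefl mult_eq_0_iff right_minus_eq zero_eq_power2)
  have step: "w i = w j" if "(i, j) \<in> E" for i j
    using pos[OF diag[of i]] pos[OF edge[OF that]] by (cases "i = j") auto
  have "(i, j) \<in> E\<^sup>*" using G by (simp add: undirected_connected_def)
  then show ?thesis by (induction rule: rtrancl_induct) (auto dest: step)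
qed

text \<open>Subtracting the averaging matrix has the effect of centring \<open>y\<close> before applying \<open>W\<close>. If \<open>W\<close> keeps the
energy of the centred vector, that vector is constant and hence \<open>0\<close>.\<close>

lemma consensus_matrix_strict_contraction:
  fixes W :: "real^'n^'n::finite"
  assumes G: "undirected_connected E" and W: "consensus_matrix E W" and y: "y \<noteq> 0"
  shows "norm ((W - (\<chi> i j. 1 / real CARD('n))) *v y) < norm y"
proof -
  define m where "m = (\<Sum>j\<in>UNIV. y $ j) / real CARD('n)"
  define w where "w j = y $ j - m" for j
  have D: "doubly_stochastic W" using W by (simp add: consensus_matrix_def)
  note DD = doubly_stochasticD[OF D]
  let ?A = "W - (\<chi> i j. 1 / real CARD('n))"
  have A: "(?A *v y) $ i = (\<Sum>j\<in>UNIV. W $ i $ j * w j)" for i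
  proof -
    have "(?A *v y) $ i = (\<Sum>j\<in>UNIV. W $ i $ j * y $ j) - m"
      by (simp add: matrix_vector_mult_def left_diff_distrib sum_subtractf m_def sum_divide_distrib)
    also have "\<dots> = (\<Sum>j\<in>UNIV. W $ i $ j * w j)"
      by (simp add: w_def right_diff_distrib sum_subtractf sum_distrib_right[symmetric] DD(2))
    finally show ?thesis .
  qed
  have sq: "(norm v)\<^sup>2 = (\<Sum>j\<in>UNIV. (v $ j)\<^sup>2)" for v :: "real^'n"
    by (simp add: norm_vec_def L2_set_def sum_nonneg)
  have sumw: "(\<Sum>j\<in>UNIV. w j) = 0"
    by (simp add: w_def sum_subtractf m_def)
  have "(\<Sum>j\<in>UNIV. (y $ j)\<^sup>2) = (\<Sum>j\<in>UNIV. (w j)\<^sup>2 + (2 * m) * w j + m\<^sup>2)"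
    by (intro sum.cong) (auto simp: w_def power2_eq_square algebra_simps)
  also have "\<dots> = (\<Sum>j\<in>UNIV. (w j)\<^sup>2) + real CARD('n) * m\<^sup>2"
    by (simp add: sum.distrib sum_distrib_left[symmetric] sumw)
  finally have wy: "(\<Sum>j\<in>UNIV. (w j)\<^sup>2) \<le> (norm y)\<^sup>2" by (simp add: sq)
  let ?gap = "\<Sum>i\<in>UNIV. \<Sum>j\<in>UNIV. W $ i $ j * (w j - (\<Sum>k\<in>UNIV. W $ i $ k * w k))\<^sup>2"
  have energy: "(norm (?A *v y))\<^sup>2 = (\<Sum>j\<in>UNIV. (w j)\<^sup>2) - ?gap"
    unfolding sq A by (rule doubly_stochastic_energy[OF D])
  have "0 \<le> ?gap" using DD(1) by (intro sum_nonneg) auto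
  then consider "?gap > 0" | "?gap = 0" by linarith
  then have "(norm (?A *v y))\<^sup>2 < (norm y)\<^sup>2"
  proof cases
    case 1
    then show ?thesis using energy wy by linarith
  next
    case 2
    have c: "w i = w j" for i j by (rule consensus_deviation_eq_0[OF G W 2])
    have "real CARD('n) * w i = 0" for i
      using sumw sum.cong[of UNIV UNIV w "\<lambda>_. w i"] c by simp
    then have "w i = 0" for i by simp
    then have "(norm (?A *v y))\<^sup>2 = 0" unfolding sq A by simp
    then show ?thesis using y by simp
  qed
  then show ?thesis by (rule power2_less_imp_less) simp
qed

text \<open>Strict contraction at each point becomes a uniform bound by compactness of the unit sphere.\<close>

lemma consensus_rate_less_1:
  fixes W :: "real^'n^'n::finite"
  assumes G: "undirected_connected E" and W: "consensus_matrix E W"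
  shows "consensus_rate W < 1"
proof -
  let ?A = "W - (\<chi> i j. 1 / real CARD('n))"
  have "\<exists>y\<in>sphere 0 1. \<forall>v\<in>sphere 0 1. norm (?A *v v) \<le> norm (?A *v y)"
  proof (rule continuous_attains_sup)
    show "sphere 0 1 \<noteq> ({} :: (real^'n) set)" by simp
    show "continuous_on (sphere 0 1) (\<lambda>v. norm (?A *v v))"
      by (intro continuous_on_norm linear_continuous_on matrix_vector_mul_bounded_linear)
  qed simp
  then obtain y where y: "norm y = 1" and max: "\<And>v. norm v = 1 \<Longrightarrow> norm (?A *v v) \<le> norm (?A *v y)"
    by auto
  have "norm (?A *v v) \<le> norm (?A *v y) * norm v" for v
  proof (cases "v = 0")
    case False
    have "norm (?A *v ((1 / norm v) *\<^sub>R v)) \<le> norm (?A *v y)"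
      by (rule max) (use False in simp)
    then have "norm (?A *v v) / norm v \<le> norm (?A *v y)"
      by (simp add: matrix_vector_mult_scaleR)
    then show ?thesis using False by (simp add: field_simps)
  qed (simp add: matrix_vector_mult_0_right)
  then have "consensus_rate W \<le> norm (?A *v y)"
    unfolding consensus_rate_def by (intro onorm_le)
  also have "\<dots> < norm y"
    by (rule consensus_matrix_strict_contraction[OF G W]) (use y in auto)
  finally show ?thesis by (simp add: y)
qed

lemma agent_mean_mixing:
  fixes W :: "real^'n^'n::finite"
  assumes W: "doubly_stochastic W"
  shows "agent_mean (\<lambda>i. \<Sum>j\<in>UNIV. W $ i $ j *\<^sub>R v j) = agent_mean v"
proof -
  have "(\<Sum>i\<in>UNIV. \<Sum>j\<in>UNIV. W $ i $ j *\<^sub>R v j) = (\<Sum>j\<in>UNIV. \<Sum>i\<in>UNIV. W $ i $ j *\<^sub>R v j)"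
    by (rule sum.swap)
  also have "\<dots> = (\<Sum>j\<in>UNIV. v j)"
    by (simp add: scaleR_left.sum[symmetric] doubly_stochasticD[OF W])
  finally show ?thesis by (simp add: agent_mean_def)
qed

text \<open>The centre \<open>c\<close> is arbitrary because \<open>W\<close> minus the averaging matrix annihilates constant families;
with \<open>c\<close> the mean of the old iterates, the right-hand side contains the old deviations from the
mean. The operator norm bound is applied to each coordinate of the agents' vectors.\<close>

lemma mixing_contracts_disagreement:
  fixes W :: "real^'n^'n::finite" and v :: "'n \<Rightarrow> real^'d::finite"
  assumes W: "doubly_stochastic W"
  shows "agent_mean (\<lambda>i. (norm ((\<Sum>j\<in>UNIV. W $ i $ j *\<^sub>R v j) - agent_mean v))\<^sup>2)
    \<le> (consensus_rate W)\<^sup>2 * agent_mean (\<lambda>j. (norm (v j - c))\<^sup>2)"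
proof -
  let ?A = "W - (\<chi> i j. 1 / real CARD('n))"
  define y where "y k = (\<chi> j. (v j - c) $ k)" for k
  have sq: "(norm w)\<^sup>2 = (\<Sum>j\<in>UNIV. (w $ j)\<^sup>2)" for w :: "real^'m::finite"
    by (simp add: norm_vec_def L2_set_def sum_nonneg)
  have comp: "((\<Sum>j\<in>UNIV. W $ i $ j *\<^sub>R v j) - agent_mean v) $ k = (?A *v y k) $ i" for i k
  proof -
    have "(?A *v y k) $ i = (\<Sum>j\<in>UNIV. W $ i $ j * (v j $ k)) - (\<Sum>j\<in>UNIV. W $ i $ j) * (c $ k)
        - ((\<Sum>j\<in>UNIV. v j $ k) / real CARD('n) - c $ k)"
      by (simp add: matrix_vector_mult_def y_def left_diff_distrib right_diff_distrib sum_subtractf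
          sum_distrib_right sum_divide_distrib)
    then show ?thesis
      by (simp add: doubly_stochasticD[OF W] agent_mean_def)
  qed
  have "(\<Sum>i\<in>UNIV. (norm ((\<Sum>j\<in>UNIV. W $ i $ j *\<^sub>R v j) - agent_mean v))\<^sup>2)
      = (\<Sum>i\<in>UNIV. \<Sum>k\<in>UNIV. ((?A *v y k) $ i)\<^sup>2)"
    unfolding sq comp ..
  also have "\<dots> = (\<Sum>k\<in>UNIV. (norm (?A *v y k))\<^sup>2)"
    unfolding sq by (rule sum.swap)
  also have "\<dots> \<le> (\<Sum>k\<in>UNIV. (consensus_rate W * norm (y k))\<^sup>2)"
    unfolding consensus_rate_def
    by (intro sum_mono power_mono onorm matrix_vector_mul_bounded_linear) auto
  also have "\<dots> = (consensus_rate W)\<^sup>2 * (\<Sum>k\<in>UNIV. \<Sum>j\<in>UNIV. ((v j - c) $ k)\<^sup>2)"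
    by (simp add: power_mult_distrib sum_distrib_left[symmetric] sq y_def)
  also have "(\<Sum>k\<in>UNIV. \<Sum>j\<in>UNIV. ((v j - c) $ k)\<^sup>2) = (\<Sum>j\<in>UNIV. (norm (v j - c))\<^sup>2)"
    unfolding sq by (rule sum.swap)
  finally show ?thesis
    by (simp add: agent_mean_def divide_right_mono)
qed

section \<open>Rates from perturbed linear recursions\<close>

text \<open>The sequence moves towards \<open>w n\<close> with weight \<open>p n\<close>. Since the weights have infinite sum, the
initial value is forgotten: the excess over the target shrinks at least like
\<open>exp (- (\<Sum>k<n. p k))\<close>.\<close>

lemma weighted_recursion_eventually_le:
  fixes y p w :: "nat \<Rightarrow> real"
  assumes p: "eventually (\<lambda>n. 0 \<le> p n \<and> p n \<le> 1) sequentially"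
    and div: "filterlim (\<lambda>n. \<Sum>k<n. p k) at_top sequentially"
    and w: "\<And>\<epsilon>. \<epsilon> > 0 \<Longrightarrow> eventually (\<lambda>n. w n \<le> K + \<epsilon>) sequentially"
    and rec: "eventually (\<lambda>n. y (Suc n) \<le> (1 - p n) * y n + p n * w n) sequentially"
    and \<epsilon>: "\<epsilon> > 0"
  shows "eventually (\<lambda>n. y n \<le> K + \<epsilon>) sequentially"
proof -
  define c where "c = K + \<epsilon> / 2"
  have "eventually (\<lambda>n. (0 \<le> p n \<and> p n \<le> 1) \<and> w n \<le> c \<and> y (Suc n) \<le> (1 - p n) * y n + p n * w n) sequentially"
    using p w[of "\<epsilon> / 2"] rec \<epsilon> by (simp add: eventually_conj_iff c_def)
  then obtain N where N: "\<And>n. n \<ge> N \<Longrightarrow> 0 \<le> p n \<and> p n \<le> 1 \<and> w n \<le> c \<and> y (Suc n) \<le> (1 - p n) * y n + p n * w n"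
    by (auto simp: eventually_sequentially)
  define P where "P n = (\<Sum>k<n. p k)" for n
  define B where "B = max 0 (y N - c) * exp (P N)"
  have B: "B \<ge> 0" by (simp add: B_def)
  have bound: "y n - c \<le> B * exp (- P n)" if "n \<ge> N" for n
    using that
  proof (induction n rule: dec_induct)
    case base
    show ?case by (simp add: B_def mult.assoc exp_add[symmetric])
  next
    case (step n)
    have "y (Suc n) - c \<le> (1 - p n) * (y n - c) + p n * (w n - c)"
      using N[OF step.hyps(1)] by (simp add: algebra_simps)
    also have "\<dots> \<le> (1 - p n) * (y n - c)"
      using N[OF step.hyps(1)] by (simp add: mult_nonneg_nonpos)
    also have "\<dots> \<le> (1 - p n) * (B * exp (- P n))"
      using N[OF step.hyps(1)] step.IH by (intro mult_left_mono) auto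
    also have "\<dots> \<le> exp (- p n) * (B * exp (- P n))"
      using exp_ge_add_one_self[of "- p n"] B by (intro mult_right_mono) auto
    also have "\<dots> = B * exp (- P (Suc n))"
      by (simp add: P_def exp_add[symmetric] exp_diff exp_minus field_simps)
    finally show ?case .
  qed
  have "filterlim P at_top sequentially" using div by (simp add: P_def[abs_def])
  then have "((\<lambda>n. B * exp (- P n)) \<longlongrightarrow> B * 0) sequentially"
    by (intro tendsto_mult tendsto_const filterlim_compose[OF exp_at_bot]
        filterlim_compose[OF filterlim_uminus_at_bot_at_top])
  then have "eventually (\<lambda>n. B * exp (- P n) < \<epsilon> / 2) sequentially"
    using \<epsilon> by (intro order_tendstoD(2)) auto
  then show ?thesis
    using eventually_ge_at_top[of N]
  proof eventually_elim
    case (elim n)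
    then show ?case using bound[of n] by (simp add: c_def field_simps)
  qed
qed

lemma shifted_at_top: "filterlim (\<lambda>n. real n + c) at_top sequentially"
  using filterlim_tendsto_add_at_top[OF tendsto_const[of c] filterlim_real_sequentially]
  by (simp add: add.commute)

lemma filterlim_at_top_of_shift:
  fixes f :: "nat \<Rightarrow> real"
  assumes "filterlim (\<lambda>n. f (n + m)) at_top sequentially"
  shows "filterlim f at_top sequentially"
  unfolding filterlim_at_top
proof (rule allI)
  fix Z
  have "eventually (\<lambda>n. Z \<le> f (n + m)) sequentially"
    using assms by (simp add: filterlim_at_top)
  then show "eventually (\<lambda>n. Z \<le> f n) sequentially"
    by (simp add: eventually_sequentially_seg[of "\<lambda>n. Z \<le> f n" m])
qed

lemma eventually_shifted_gt: "eventually (\<lambda>n. real n + c > K) sequentially"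
  using shifted_at_top[of c] by (auto simp: filterlim_at_top_dense)

lemma sum_inverse_shifted_at_top:
  assumes a: "a > (0::real)"
  shows "filterlim (\<lambda>n. \<Sum>k<n. a / (real k + c)) at_top sequentially"
proof -
  define m where "m = nat \<lceil>\<bar>c\<bar>\<rceil> + 1"
  have m: "c \<le> real m - 1" "- real m + 1 \<le> c" unfolding m_def by linarith+
  define h where "h n = (\<Sum>k<n. a / (real k + c))" for n
  have le: "a * (harm (n + 2 * m) - harm (2 * m)) + h m \<le> h (n + m)" for n
  proof (induction n)
    case (Suc n)
    have "a / (real (n + 2 * m) + 1) \<le> a / (real (n + m) + c)"
      using a m by (intro divide_left_mono) auto
    then show ?case using Suc
      by (simp add: h_def harm_Suc algebra_simps inverse_eq_divide)
  qed simp
  have "filterlim (\<lambda>n. harm (n + 2 * m) :: real) at_top sequentially"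
    using filterlim_compose[OF harm_at_top filterlim_add_const_nat_at_top] .
  then have "filterlim (\<lambda>n. (a * (- harm (2 * m)) + h m) + a * harm (n + 2 * m)) at_top sequentially"
    using a by (intro filterlim_tendsto_add_at_top[OF tendsto_const]
        filterlim_tendsto_pos_mult_at_top[OF tendsto_const])
  then have "filterlim (\<lambda>n. h (n + m)) at_top sequentially"
    by (rule filterlim_at_top_mono) (use le in \<open>auto simp: algebra_simps\<close>)
  then have "filterlim h at_top sequentially"
    by (rule filterlim_at_top_of_shift)
  then show ?thesis by (simp add: h_def[abs_def])
qed

text \<open>Multiplying by \<open>s = t + c\<close> turns the factor \<open>1 - b/(s + 1)\<close> into \<open>(s + 1 - b)/s = 1 - (b - 1)/s\<close>, so
\<open>s * a\<close> is a weighted recursion with weights \<open>(b - 1)/s\<close>, whose sum diverges.\<close>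

lemma chung_recursion:
  fixes a D :: "nat \<Rightarrow> real"
  assumes b: "b > 1" and K: "K \<ge> 0"
    and D: "\<And>\<epsilon>. \<epsilon> > 0 \<Longrightarrow> eventually (\<lambda>t. D t \<le> K + \<epsilon>) sequentially"
    and rec: "eventually (\<lambda>t. a (Suc t) \<le> (1 - b / (real (Suc t) + c)) * a t
        + D t / (real (Suc t) + c)\<^sup>2) sequentially"
    and \<epsilon>: "\<epsilon> > 0"
  shows "eventually (\<lambda>t. (real t + c) * a t \<le> K / (b - 1) + \<epsilon>) sequentially"
proof (rule weighted_recursion_eventually_le[where y = "\<lambda>t. (real t + c) * a t"
      and p = "\<lambda>t. (b - 1) / (real t + c)"
      and w = "\<lambda>t. D t / (b - 1) * ((real t + c) / (real (Suc t) + c))", OF _ _ _ _ \<epsilon>])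
  show "\<forall>\<^sub>F t in sequentially. 0 \<le> (b - 1) / (real t + c) \<and> (b - 1) / (real t + c) \<le> 1"
    using eventually_shifted_gt[of "b - 1" c]
    by eventually_elim (use b in \<open>auto simp: field_simps\<close>)
  show "filterlim (\<lambda>n. \<Sum>k<n. (b - 1) / (real k + c)) at_top sequentially"
    using b by (intro sum_inverse_shifted_at_top) simp
  show "\<forall>\<^sub>F t in sequentially. D t / (b - 1) * ((real t + c) / (real (Suc t) + c)) \<le> K / (b - 1) + e"
    if e: "e > 0" for e
  proof -
    have "\<forall>\<^sub>F t in sequentially. D t \<le> K + e * (b - 1)"
      using e b by (intro D) simp
    then show ?thesis
      using eventually_shifted_gt[of 0 c]
    proof eventually_elim
      case (elim t)
      have r: "0 \<le> (real t + c) / (real (Suc t) + c)" "(real t + c) / (real (Suc t) + c) \<le> 1"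
        using elim by (auto simp: field_simps)
      have "D t / (b - 1) * ((real t + c) / (real (Suc t) + c))
          \<le> (K + e * (b - 1)) / (b - 1) * ((real t + c) / (real (Suc t) + c))"
        using elim b r by (intro mult_right_mono divide_right_mono) auto
      also have "\<dots> \<le> (K + e * (b - 1)) / (b - 1) * 1"
        using r b K e by (intro mult_left_mono) auto
      also have "\<dots> = K / (b - 1) + e"
        using b by (simp add: field_simps)
      finally show ?case .
    qed
  qed
  show "\<forall>\<^sub>F t in sequentially. (real (Suc t) + c) * a (Suc t) \<le>
      (1 - (b - 1) / (real t + c)) * ((real t + c) * a t) +
      (b - 1) / (real t + c) * (D t / (b - 1) * ((real t + c) / (real (Suc t) + c)))"
    using rec eventually_shifted_gt[of 0 c]
  proof eventually_elim
    case (elim t)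
    define s where "s = real t + c"
    have s: "s > 0" "real (Suc t) + c = s + 1" using elim by (auto simp: s_def)
    have "(s + 1) * a (Suc t) \<le> (s + 1) * ((1 - b / (s + 1)) * a t + D t / (s + 1)\<^sup>2)"
      using elim(1) s(1) unfolding s(2) by (intro mult_left_mono) auto
    also have "\<dots> = (s + 1 - b) * a t + D t / (s + 1)"
    proof -
      have "r * ((1 - b / r) * a t + D t / r\<^sup>2) = (r - b) * a t + D t / r" if "r > 0" for r
        using that by (simp add: field_simps power2_eq_square)
      then show ?thesis using s(1) by simp
    qed
    also have "(s + 1 - b) * a t = (1 - (b - 1) / s) * (s * a t)"
      using s(1) by (simp add: field_simps)
    also have "D t / (s + 1) = (b - 1) / s * (D t / (b - 1) * (s / (s + 1)))"
      using s(1) b by simp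
    finally show ?case unfolding s(2) s_def[symmetric] .
  qed
qed

text \<open>After multiplication by \<open>(t + c)\<^sup>2\<close> the contraction factor is \<open>r t = q ((t + 1 + c)/(t + c))\<^sup>2\<close>,
which tends to \<open>q < 1\<close>; the weights \<open>1 - r t\<close> stay away from \<open>0\<close>.\<close>

lemma geometric_recursion:
  fixes a D :: "nat \<Rightarrow> real"
  assumes q: "0 \<le> q" "q < 1" and K: "K \<ge> 0"
    and D: "\<And>\<epsilon>. \<epsilon> > 0 \<Longrightarrow> eventually (\<lambda>t. D t \<le> K + \<epsilon>) sequentially"
    and rec: "eventually (\<lambda>t. a (Suc t) \<le> q * a t + D t / (real (Suc t) + c)\<^sup>2) sequentially"
    and \<epsilon>: "\<epsilon> > 0"
  shows "eventually (\<lambda>t. (real t + c)\<^sup>2 * a t \<le> K / (1 - q) + \<epsilon>) sequentially"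
proof -
  define r where "r t = q * (1 + 1 / (real t + c))\<^sup>2" for t
  have "(\<lambda>t. 1 / (real t + c)) \<longlonglongrightarrow> 0"
    using tendsto_divide_0[OF tendsto_const filterlim_at_top_imp_at_infinity[OF shifted_at_top]] .
  then have "r \<longlonglongrightarrow> q * (1 + 0)\<^sup>2"
    unfolding r_def[abs_def] by (intro tendsto_intros)
  then have r: "r \<longlonglongrightarrow> q" by simp
  have r_lt: "eventually (\<lambda>t. r t < (1 + q) / 2) sequentially"
    using r q by (intro order_tendstoD(2)) auto
  have r_nn: "0 \<le> r t" for t using q by (simp add: r_def)
  show ?thesis
  proof (rule weighted_recursion_eventually_le[where y = "\<lambda>t. (real t + c)\<^sup>2 * a t"
        and p = "\<lambda>t. 1 - r t" and w = "\<lambda>t. D t / (1 - r t)", OF _ _ _ _ \<epsilon>])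
    show "\<forall>\<^sub>F t in sequentially. 0 \<le> 1 - r t \<and> 1 - r t \<le> 1"
      using r_lt by eventually_elim (use r_nn q in auto)
    show "filterlim (\<lambda>n. \<Sum>k<n. 1 - r k) at_top sequentially"
    proof -
      obtain N where N: "\<And>n. n \<ge> N \<Longrightarrow> r n < (1 + q) / 2"
        using r_lt by (auto simp: eventually_sequentially)
      have le: "(\<Sum>k<N. 1 - r k) + (1 - q) / 2 * real n \<le> (\<Sum>k<n + N. 1 - r k)" for n
      proof (induction n)
        case (Suc n)
        show ?case using Suc N[of "n + N"] by (simp add: field_simps)
      qed simp
      have "filterlim (\<lambda>n. (\<Sum>k<N. 1 - r k) + (1 - q) / 2 * real n) at_top sequentially"
        using q by (intro filterlim_tendsto_add_at_top[OF tendsto_const]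
            filterlim_tendsto_pos_mult_at_top[OF tendsto_const] filterlim_real_sequentially) auto
      then have "filterlim (\<lambda>n. \<Sum>k<n + N. 1 - r k) at_top sequentially"
        by (rule filterlim_at_top_mono) (use le in auto)
      then show ?thesis by (rule filterlim_at_top_of_shift)
    qed
    show "\<forall>\<^sub>F t in sequentially. D t / (1 - r t) \<le> K / (1 - q) + e" if e: "e > 0" for e
    proof -
      define e' where "e' = e / 2 * (1 - q)"
      have e': "e' > 0" using e q by (simp add: e'_def)
      have "(\<lambda>t. (K + e') / (1 - r t)) \<longlonglongrightarrow> (K + e') / (1 - q)"
        using r q by (intro tendsto_intros) auto
      moreover have "e' / (1 - q) = e / 2"
        unfolding e'_def by (rule nonzero_mult_div_cancel_right) (use q in simp)
      then have "(K + e') / (1 - q) < K / (1 - q) + e"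
        using e by (simp add: add_divide_distrib)
      ultimately have "\<forall>\<^sub>F t in sequentially. (K + e') / (1 - r t) < K / (1 - q) + e"
        by (rule order_tendstoD(2))
      with D[OF e'] r_lt show ?thesis
      proof eventually_elim
        case (elim t)
        have "D t / (1 - r t) \<le> (K + e') / (1 - r t)"
          using elim q by (intro divide_right_mono) auto
        then show ?case using elim by linarith
      qed
    qed
    show "\<forall>\<^sub>F t in sequentially. (real (Suc t) + c)\<^sup>2 * a (Suc t)
        \<le> (1 - (1 - r t)) * ((real t + c)\<^sup>2 * a t) + (1 - r t) * (D t / (1 - r t))"
      using rec eventually_shifted_gt[of 0 c] r_lt
    proof eventually_elim
      case (elim t)
      define s where "s = real t + c"
      have s: "s > 0" "real (Suc t) + c = s + 1" using elim by (auto simp: s_def)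
      have rs: "r t * s\<^sup>2 = q * (s + 1)\<^sup>2"
      proof -
        have "r t * s\<^sup>2 = q * ((1 + 1 / s) * s)\<^sup>2"
          unfolding r_def s_def by (simp only: power_mult_distrib mult.assoc)
        also have "(1 + 1 / s) * s = s + 1" using s(1) by (simp add: field_simps)
        finally show ?thesis .
      qed
      have "(s + 1)\<^sup>2 * a (Suc t) \<le> (s + 1)\<^sup>2 * (q * a t + D t / (s + 1)\<^sup>2)"
        using elim(1) unfolding s(2) by (intro mult_left_mono) auto
      also have "\<dots> = (q * (s + 1)\<^sup>2) * a t + D t"
        using s(1) by (simp add: distrib_left)
      also have "\<dots> = (1 - (1 - r t)) * (s\<^sup>2 * a t) + (1 - r t) * (D t / (1 - r t))"
        using elim q by (simp add: rs[symmetric])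
      finally show ?case unfolding s(2) s_def[symmetric] .
    qed
  qed
qed

lemma eventually_add_inverse_le:
  assumes "\<epsilon> > (0::real)"
  shows "eventually (\<lambda>t. K + B / (real t + c) \<le> K + \<epsilon>) sequentially"
proof -
  have "(\<lambda>t. B / (real t + c)) \<longlonglongrightarrow> 0"
    using tendsto_divide_0[OF tendsto_const filterlim_at_top_imp_at_infinity[OF shifted_at_top]] .
  then have "eventually (\<lambda>t. B / (real t + c) < \<epsilon>) sequentially"
    using assms by (rule order_tendstoD(2))
  then show ?thesis by eventually_elim simp
qed

text \<open>The sum \<open>\<delta> + e\<close> satisfies a recursion as in \<open>chung_recursion\<close>, since for large \<open>t\<close> the factor \<open>q\<close> in
front of \<open>e\<close> is below \<open>1 - b'/s\<close>. This gives \<open>\<delta>, e = O(1/s)\<close>. Then the perturbation in the recursion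
for \<open>e\<close> tends to \<open>K2\<close>, which gives the rate of \<open>e\<close>, and with \<open>e = O(1/s\<^sup>2)\<close> the coupling term \<open>c2 e/s\<close>
becomes negligible in the recursion for \<open>\<delta>\<close>.\<close>

lemma coupled_recursion_rates:
  fixes \<delta> e :: "nat \<Rightarrow> real"
  assumes nn: "\<And>t. 0 \<le> \<delta> t" "\<And>t. 0 \<le> e t"
    and b: "b > 1" and q: "0 \<le> q" "q < 1"
    and coeffs: "0 \<le> K1" "0 \<le> K2" "0 \<le> c1" "0 \<le> c2" "0 \<le> c3" "0 \<le> c4" "0 \<le> c5" "0 \<le> c6" "0 \<le> c7"
    and rec_\<delta>: "eventually (\<lambda>t. \<delta> (Suc t) \<le> (1 - b / (real (Suc t) + c) + c1 / (real (Suc t) + c)\<^sup>2) * \<delta> t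
        + (c2 / (real (Suc t) + c) + c3 / (real (Suc t) + c)\<^sup>2) * e t
        + (K1 + c4 / (real (Suc t) + c)) / (real (Suc t) + c)\<^sup>2) sequentially"
    and rec_e: "eventually (\<lambda>t. e (Suc t) \<le> q * e t
        + (K2 + c5 * \<delta> t + c6 * e t + c7 / (real (Suc t) + c)) / (real (Suc t) + c)\<^sup>2) sequentially"
    and \<epsilon>: "\<epsilon> > 0"
  shows "eventually (\<lambda>t. (real t + c) * \<delta> t \<le> K1 / (b - 1) + \<epsilon>) sequentially"
    and "eventually (\<lambda>t. (real t + c)\<^sup>2 * e t \<le> K2 / (1 - q) + \<epsilon>) sequentially"
proof -
  \<comment> \<open>A contraction constant strictly between \<open>1\<close> and \<open>b\<close>, so that the slack \<open>(b - b')/s\<close> absorbs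
    the terms of order \<open>1/s\<^sup>2\<close>.\<close>
  define b' where "b' = (b + 1) / 2"
  have b': "1 < b'" "b' < b" using b by (auto simp: b'_def)
  define C where "C = K1 + K2 + c4 + c7"
  have C: "0 \<le> C" using coeffs by (simp add: C_def)
  have ev0: "eventually (\<lambda>t. real (Suc t) + c > 1) sequentially"
    using eventually_shifted_gt[of 1 c] by eventually_elim simp
  have ev1: "eventually (\<lambda>t. real (Suc t) + c > (c1 + c5) / (b - b')) sequentially"
    using eventually_shifted_gt[of "(c1 + c5) / (b - b')" c] by eventually_elim simp
  have ev2: "eventually (\<lambda>t. real (Suc t) + c > (c2 + c3 + c6 + b') / (1 - q)) sequentially"
    using eventually_shifted_gt[of "(c2 + c3 + c6 + b') / (1 - q)" c] by eventually_elim simp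
  have "eventually (\<lambda>t. \<delta> (Suc t) + e (Suc t) \<le> (1 - b' / (real (Suc t) + c)) * (\<delta> t + e t)
      + C / (real (Suc t) + c)\<^sup>2) sequentially"
    using rec_\<delta> rec_e ev0 ev1 ev2
  proof eventually_elim
    case (elim t)
    define s where "s = real (Suc t) + c"
    note el = elim[folded s_def]
    have s: "s > 1" using el by simp
    have "c1 + c5 \<le> (b - b') * s" using el(4) b' by (simp add: field_simps)
    then have "(c1 + c5) / s\<^sup>2 \<le> (b - b') * s / s\<^sup>2" by (intro divide_right_mono) auto
    then have 1: "1 - b / s + (c1 + c5) / s\<^sup>2 \<le> 1 - b' / s"
      using s by (simp add: power2_eq_square diff_divide_distrib)
    have "c2 + c3 + c6 + b' \<le> (1 - q) * s" using el(5) q by (simp add: field_simps)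
    then have "(c2 + c3 + c6 + b') / s \<le> (1 - q) * s / s" using s by (intro divide_right_mono) auto
    then have "(c2 + c3 + c6 + b') / s \<le> 1 - q" using s by simp
    moreover have "(c3 + c6) / s\<^sup>2 \<le> (c3 + c6) / s"
      using coeffs s by (intro divide_left_mono) (auto simp: power2_eq_square)
    ultimately have 2: "q + c2 / s + (c3 + c6) / s\<^sup>2 \<le> 1 - b' / s"
      by (simp add: add_divide_distrib)
    have "c4 / s \<le> c4" "c7 / s \<le> c7"
      using coeffs s by (auto simp: field_simps mult_le_cancel_left1 mult_left_le)
    then have 3: "(K1 + K2 + c4 / s + c7 / s) / s\<^sup>2 \<le> C / s\<^sup>2"
      unfolding C_def by (intro divide_right_mono) auto
    have "\<delta> (Suc t) + e (Suc t) \<le> (1 - b / s + (c1 + c5) / s\<^sup>2) * \<delta> t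
        + (q + c2 / s + (c3 + c6) / s\<^sup>2) * e t + (K1 + K2 + c4 / s + c7 / s) / s\<^sup>2"
      using el(1,2) by (simp add: add_divide_distrib distrib_right)
    also have "\<dots> \<le> (1 - b' / s) * \<delta> t + (1 - b' / s) * e t + C / s\<^sup>2"
      using 1 2 3 nn by (intro add_mono mult_right_mono) auto
    finally show ?case by (simp add: s_def distrib_left)
  qed
  note rec_sum = this
  define B where "B = C / (b' - 1) + 1"
  have "eventually (\<lambda>t. (real t + c) * (\<delta> t + e t) \<le> B) sequentially"
    unfolding B_def by (rule chung_recursion[OF b'(1) C _ rec_sum]) auto
  then have bound: "eventually (\<lambda>t. \<delta> t \<le> B / (real t + c) \<and> e t \<le> B / (real t + c)) sequentially"
    using eventually_shifted_gt[of 0 c]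
  proof eventually_elim
    case (elim t)
    have "(real t + c) * \<delta> t \<le> B" "(real t + c) * e t \<le> B"
      using elim mult_nonneg_nonneg[of "real t + c" "\<delta> t"] mult_nonneg_nonneg[of "real t + c" "e t"] nn[of t]
      by (simp_all add: distrib_left, linarith+)
    then show ?case using elim by (auto simp: field_simps)
  qed
  have inv_le: "x / (real (Suc t) + c) \<le> x / (real t + c)" if "real t + c > 0" "x \<ge> 0" for x t
    using that by (intro divide_left_mono) auto
  have De: "eventually (\<lambda>t. K2 + c5 * \<delta> t + c6 * e t + c7 / (real (Suc t) + c) \<le> K2 + \<epsilon>) sequentially"
    if "\<epsilon> > 0" for \<epsilon>
    using bound eventually_shifted_gt[of 0 c] eventually_add_inverse_le[OF that, of K2 "c5 * B + c6 * B + c7" c]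
  proof eventually_elim
    case (elim t)
    have "c5 * \<delta> t \<le> c5 * (B / (real t + c))" "c6 * e t \<le> c6 * (B / (real t + c))"
      using elim coeffs by (auto intro!: mult_left_mono simp del: times_divide_eq_right)
    then show ?case using elim inv_le[of t c7] coeffs by (simp add: add_divide_distrib)
  qed
  have e_rate: "eventually (\<lambda>t. (real t + c)\<^sup>2 * e t \<le> K2 / (1 - q) + \<epsilon>) sequentially" if "\<epsilon> > 0" for \<epsilon>
    by (rule geometric_recursion[OF q coeffs(2) De rec_e that])
  then show "eventually (\<lambda>t. (real t + c)\<^sup>2 * e t \<le> K2 / (1 - q) + \<epsilon>) sequentially"
    using \<epsilon> .
  define B2 where "B2 = K2 / (1 - q) + 1"
  have e_small: "eventually (\<lambda>t. (real (Suc t) + c) * e t \<le> (2 * B2) / (real t + c)) sequentially"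
    using e_rate[OF zero_less_one] eventually_shifted_gt[of 1 c]
  proof eventually_elim
    case (elim t)
    define s where "s = real t + c"
    have s: "s > 1" using elim by (simp add: s_def)
    have "(s + 1) * e t \<le> (2 * s) * e t" using s nn by (intro mult_right_mono) auto
    also have "\<dots> = 2 * (s\<^sup>2 * e t) / s" using s by (simp add: power2_eq_square)
    also have "\<dots> \<le> 2 * B2 / s"
      using elim s by (intro divide_right_mono mult_left_mono) (auto simp: s_def B2_def)
    finally show ?case by (simp add: s_def algebra_simps)
  qed
  define D where "D t = K1 + c1 * \<delta> t + c2 * ((real (Suc t) + c) * e t) + c3 * e t + c4 / (real (Suc t) + c)" for t
  have D\<delta>: "eventually (\<lambda>t. D t \<le> K1 + \<epsilon>) sequentially" if "\<epsilon> > 0" for \<epsilon>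
    using bound e_small eventually_shifted_gt[of 0 c]
      eventually_add_inverse_le[OF that, of K1 "c1 * B + c2 * (2 * B2) + c3 * B + c4" c]
  proof eventually_elim
    case (elim t)
    have "c1 * \<delta> t \<le> c1 * (B / (real t + c))" "c3 * e t \<le> c3 * (B / (real t + c))"
      "c2 * ((real (Suc t) + c) * e t) \<le> c2 * (2 * B2 / (real t + c))"
      using elim coeffs by (auto intro!: mult_left_mono simp del: of_nat_Suc times_divide_eq_right)
    then show ?case using elim inv_le[of t c4] coeffs
      by (simp add: add_divide_distrib D_def)
  qed
  show "eventually (\<lambda>t. (real t + c) * \<delta> t \<le> K1 / (b - 1) + \<epsilon>) sequentially"
  proof (rule chung_recursion[OF b coeffs(1) D\<delta> _ \<epsilon>])
    show "\<forall>\<^sub>F t in sequentially. \<delta> (Suc t) \<le> (1 - b / (real (Suc t) + c)) * \<delta> t + D t / (real (Suc t) + c)\<^sup>2"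
      using rec_\<delta> ev0
    proof eventually_elim
      case (elim t)
      define s where "s = real (Suc t) + c"
      have s: "s > 1" using elim by (simp add: s_def)
      have "c2 * (s * e t) / s\<^sup>2 = c2 / s * e t" using s by (simp add: power2_eq_square)
      then show ?case
        using elim unfolding D_def s_def[symmetric]
        by (simp add: add_divide_distrib distrib_right)
    qed
  qed
qed

text \<open>The positive part of the excess over \<open>K * g\<close> serves as the remainder.\<close>

lemma eventually_rate_imp_smallo:
  fixes a s g :: "nat \<Rightarrow> real"
  assumes lim: "(\<lambda>t. g t * s t) \<longlonglongrightarrow> 1" and K: "K \<ge> 0"
    and s: "eventually (\<lambda>t. s t > 0) sequentially" and g: "eventually (\<lambda>t. g t > 0) sequentially"
    and a: "\<And>\<epsilon>. \<epsilon> > 0 \<Longrightarrow> eventually (\<lambda>t. s t * a t \<le> K + \<epsilon>) sequentially"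
  shows "\<exists>r\<in>o(g). eventually (\<lambda>t. a t \<le> K * g t + r t) sequentially"
proof (intro bexI[of _ "\<lambda>t. max 0 (a t - K * g t)"])
  show "(\<lambda>t. max 0 (a t - K * g t)) \<in> o(g)"
  proof (rule landau_o.smallI)
    fix \<epsilon> :: real assume \<epsilon>: "\<epsilon> > 0"
    have "(\<lambda>t. (K + \<epsilon>) * (g t * s t)) \<longlonglongrightarrow> (K + \<epsilon>) * 1"
      by (intro tendsto_intros lim)
    then have "eventually (\<lambda>t. K + \<epsilon> / 2 < (K + \<epsilon>) * (g t * s t)) sequentially"
      using \<epsilon> by (intro order_tendstoD(1)) auto
    moreover have "eventually (\<lambda>t. s t * a t \<le> K + \<epsilon> / 2) sequentially"
      using \<epsilon> by (intro a) simp
    ultimately show "\<forall>\<^sub>F t in sequentially. norm (max 0 (a t - K * g t)) \<le> \<epsilon> * norm (g t)"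
      using s g
    proof eventually_elim
      case (elim t)
      have "a t * s t \<le> K + \<epsilon> / 2" using elim(2) by (simp only: mult.commute)
      also have "\<dots> \<le> ((K + \<epsilon>) * g t) * s t" using elim(1) by (simp only: mult.assoc less_imp_le)
      finally have "a t \<le> (K + \<epsilon>) * g t" by (rule mult_right_le_imp_le) (rule elim(3))
      then show ?case using elim \<epsilon> by (simp add: distrib_right)
    qed
  qed
qed (auto intro: always_eventually)

section \<open>Averaging over a fresh direction\<close>

lemma smooth_with_continuous_on_compose:
  assumes "smooth_with L h" "continuous_on S g"
  shows "continuous_on S (\<lambda>x. h (g x))"
  using continuous_on_compose2[OF smooth_with_continuous_on[OF assms(1), of UNIV] assms(2)] by simp

lemma gradient_continuous_on_compose:
  assumes "smooth_with L h" "continuous_on S g"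
  shows "continuous_on S (\<lambda>x. gradient h (g x))"
  using continuous_on_compose2[OF _ assms(2), of UNIV "gradient h"] assms(1)
  by (simp add: smooth_with_def)

lemma grad_est2_continuous_on:
  assumes "smooth_with L h" "continuous_on S f" "continuous_on S g"
  shows "continuous_on S (\<lambda>x. grad_est2 h (f x) u (g x))"
  unfolding grad_est2_def divide_inverse
  by (intro continuous_intros smooth_with_continuous_on_compose[OF assms(1)] assms(2,3))

lemma integral_agent_mean:
  fixes F :: "'n::finite \<Rightarrow> 'w \<Rightarrow> real"
  assumes "\<And>i. integrable M (F i)"
  shows "integrable M (\<lambda>\<omega>. agent_mean (\<lambda>i. F i \<omega>))"
    and "(\<integral>\<omega>. agent_mean (\<lambda>i. F i \<omega>) \<partial>M) = agent_mean (\<lambda>i. \<integral>\<omega>. F i \<omega> \<partial>M)"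
  using assms by (simp_all add: agent_mean_def)

lemma (in prob_space) integrable_continuous_of_bounded:
  fixes Y :: "'a \<Rightarrow> 'b::euclidean_space" and \<Psi> :: "'b \<Rightarrow> real"
  assumes Y: "Y \<in> borel_measurable M" and bound: "AE \<omega> in M. norm (Y \<omega>) \<le> R"
    and \<Psi>: "continuous_on UNIV \<Psi>"
  shows "integrable M (\<lambda>\<omega>. \<Psi> (Y \<omega>))"
proof -
  have "compact (\<Psi> ` cball 0 R)"
    by (intro compact_continuous_image continuous_on_subset[OF \<Psi>]) auto
  then obtain B where B: "\<And>y. norm y \<le> R \<Longrightarrow> norm (\<Psi> y) \<le> B"
    using compact_imp_bounded by (fastforce simp: bounded_iff)
  have "\<Psi> \<in> borel_measurable borel" by (rule borel_measurable_continuous_onI[OF \<Psi>])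
  then have "(\<lambda>\<omega>. \<Psi> (Y \<omega>)) \<in> borel_measurable M" using Y by simp
  then show ?thesis
    using bound B by (intro integrable_const_bound[where B=B]) (auto elim: eventually_mono)
qed

text \<open>This takes the place of conditioning on the past: \<open>X\<close> is the current state, \<open>Z\<close> a direction
independent of it, and the joint law is a product, so the direction can be integrated out
first.\<close>

lemma (in prob_space) expectation_le_of_fresh_sample:
  fixes \<Phi> :: "'x \<Rightarrow> 'z \<Rightarrow> real"
  assumes X[measurable]: "X \<in> measurable M N" and Zm[measurable]: "Z \<in> measurable M K"
    and indep: "distr M N X \<Otimes>\<^sub>M distr M K Z = distr M (N \<Otimes>\<^sub>M K) (\<lambda>\<omega>. (X \<omega>, Z \<omega>))"
    and Z: "distr M K Z = \<sigma>"
    and \<Phi>: "(\<lambda>(x, z). \<Phi> x z) \<in> borel_measurable (N \<Otimes>\<^sub>M K)"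
    and int_\<Phi>: "integrable M (\<lambda>\<omega>. \<Phi> (X \<omega>) (Z \<omega>))"
    and \<psi>: "\<psi> \<in> borel_measurable N" and int_\<psi>: "integrable M (\<lambda>\<omega>. \<psi> (X \<omega>))"
    and le: "\<And>x. x \<in> space N \<Longrightarrow> (\<integral>z. \<Phi> x z \<partial>\<sigma>) \<le> \<psi> x"
  shows "expectation (\<lambda>\<omega>. \<Phi> (X \<omega>) (Z \<omega>)) \<le> expectation (\<lambda>\<omega>. \<psi> (X \<omega>))"
proof -
  note joint = indep[unfolded Z]
  interpret PX: prob_space "distr M N X" by (rule prob_space_distr) fact
  interpret PZ: prob_space \<sigma> unfolding Z[symmetric] by (rule prob_space_distr) fact
  interpret P: pair_prob_space "distr M N X" \<sigma> ..
  have int_pair: "integrable (distr M N X \<Otimes>\<^sub>M \<sigma>) (\<lambda>(x, z). \<Phi> x z)"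
    unfolding joint using \<Phi> int_\<Phi> by (subst integrable_distr_eq) auto
  have "expectation (\<lambda>\<omega>. \<Phi> (X \<omega>) (Z \<omega>)) = (\<integral>p. (case p of (x, z) \<Rightarrow> \<Phi> x z) \<partial>(distr M N X \<Otimes>\<^sub>M \<sigma>))"
    unfolding joint using \<Phi> by (subst integral_distr) auto
  also have "\<dots> = (\<integral>x. (\<integral>z. \<Phi> x z \<partial>\<sigma>) \<partial>(distr M N X))"
    using P.integral_fst'[OF int_pair] by simp
  also have "\<dots> \<le> (\<integral>x. \<psi> x \<partial>(distr M N X))"
  proof (rule integral_mono)
    show "integrable (distr M N X) (\<lambda>x. \<integral>z. \<Phi> x z \<partial>\<sigma>)"
      using P.integrable_fst'[OF int_pair] by simp
    show "integrable (distr M N X) \<psi>"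
      using \<psi> int_\<psi> by (subst integrable_distr_eq) auto
  qed (use le in simp)
  also have "\<dots> = expectation (\<lambda>\<omega>. \<psi> (X \<omega>))"
    using \<psi> by (subst integral_distr) auto
  finally show ?thesis .
qed

text \<open>Boundedness of the state and \<open>\<parallel>Z\<parallel> = 1\<close> put \<open>(X, Z)\<close> into a compact set, on which continuous
functions are bounded and hence integrable.\<close>

lemma (in prob_space) continuous_expectation_le_of_fresh_sample:
  fixes X :: "'a \<Rightarrow> 'b::euclidean_space" and Z :: "'a \<Rightarrow> 'c::euclidean_space"
  assumes X[measurable]: "X \<in> borel_measurable M" and Zm[measurable]: "Z \<in> borel_measurable M"
    and indep: "distr M borel X \<Otimes>\<^sub>M distr M borel Z = distr M (borel \<Otimes>\<^sub>M borel) (\<lambda>\<omega>. (X \<omega>, Z \<omega>))"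
    and Z: "distr M borel Z = uniform_sphere"
    and bound: "AE \<omega> in M. norm (X \<omega>) \<le> R"
    and \<Phi>: "continuous_on UNIV (\<lambda>p. \<Phi> (fst p) (snd p))" and \<psi>: "continuous_on UNIV \<psi>"
    and le: "\<And>x. (\<integral>z. \<Phi> x z \<partial>uniform_sphere) \<le> \<psi> x"
  shows "integrable M (\<lambda>\<omega>. \<Phi> (X \<omega>) (Z \<omega>) :: real)"
    and "integrable M (\<lambda>\<omega>. \<psi> (X \<omega>))"
    and "expectation (\<lambda>\<omega>. \<Phi> (X \<omega>) (Z \<omega>)) \<le> expectation (\<lambda>\<omega>. \<psi> (X \<omega>))"
proof -
  have "AE z in distr M borel Z. norm z = 1"
    unfolding Z by (rule AE_uniform_sphere)
  then have "AE \<omega> in M. norm (Z \<omega>) = 1"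
    by (subst (asm) AE_distr_iff) auto
  with bound have XZ: "AE \<omega> in M. norm (X \<omega>, Z \<omega>) \<le> R + 1"
  proof eventually_elim
    case (elim \<omega>)
    then show ?case using norm_Pair_le[of "X \<omega>" "Z \<omega>"] by simp
  qed
  show 1: "integrable M (\<lambda>\<omega>. \<Phi> (X \<omega>) (Z \<omega>))"
    using integrable_continuous_of_bounded[OF _ XZ \<Phi>] by simp
  show 2: "integrable M (\<lambda>\<omega>. \<psi> (X \<omega>))"
    by (rule integrable_continuous_of_bounded[OF X bound \<psi>])
  show "expectation (\<lambda>\<omega>. \<Phi> (X \<omega>) (Z \<omega>)) \<le> expectation (\<lambda>\<omega>. \<psi> (X \<omega>))"
  proof (rule expectation_le_of_fresh_sample[OF X Zm indep Z _ 1 _ 2 le])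
    show "(\<lambda>(x, z). \<Phi> x z) \<in> borel_measurable (borel \<Otimes>\<^sub>M borel)"
      unfolding borel_prod using borel_measurable_continuous_onI[OF \<Phi>] by (simp add: case_prod_beta')
    show "\<psi> \<in> borel_measurable borel" by (rule borel_measurable_continuous_onI[OF \<psi>])
  qed
qed

text \<open>Here \<open>y\<close> is the mean iterate, \<open>a\<close> the gradient of the global objective at \<open>y\<close>, and \<open>x\<close> the iterate of
one agent. The error \<open>\<langle>a, \<nabla>h y - \<nabla>h x\<rangle>\<close> and the bias of the estimator may each use up a quarter
of \<open>\<parallel>a\<parallel>\<^sup>2\<close>. After averaging over the agents, \<open>\<langle>a, \<nabla>h y\<rangle>\<close> becomes \<open>\<parallel>a\<parallel>\<^sup>2\<close>, so half of the descent
remains.\<close>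

lemma expected_descent_per_agent:
  fixes h :: "real^'d::finite \<Rightarrow> real"
  assumes h: "smooth_with L h" and L: "L > 0" and u: "u > 0" and \<eta>: "\<eta> > 0"
  shows "(\<integral>z. F - \<eta> * (a \<bullet> grad_est2 h x u z) + L * \<eta>\<^sup>2 / 2 * (norm (grad_est2 h x u z))\<^sup>2 \<partial>uniform_sphere)
    \<le> F - \<eta> * (a \<bullet> gradient h y) + \<eta> / 2 * (norm a)\<^sup>2
      + \<eta> * (L\<^sup>2 * (norm (x - y))\<^sup>2 + real CARD('d) * u\<^sup>2 * L\<^sup>2 / 4)
      + L * \<eta>\<^sup>2 / 2 * (4 * real CARD('d) / 3 * (norm (gradient h x))\<^sup>2 + u\<^sup>2 * L\<^sup>2 * (real CARD('d))\<^sup>2)"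
proof -
  interpret prob_space "uniform_sphere :: (real^'d) measure" by (rule prob_space_uniform_sphere)
  let ?G = "grad_est2 h x u" and ?d = "real CARD('d)"
  have "a \<bullet> (gradient h y - gradient h x) \<le> norm a * (L * norm (x - y))"
    using norm_cauchy_schwarz[of a "gradient h y - gradient h x"] smooth_with_lipschitz[OF h, of y x]
    by (smt (verit) mult_left_mono norm_ge_zero norm_minus_commute)
  also have "\<dots> \<le> 1 / 4 * (norm a)\<^sup>2 + L\<^sup>2 * (norm (x - y))\<^sup>2"
    using zero_le_power2[of "norm a / 2 - L * norm (x - y)"]
    by (simp add: power2_eq_square algebra_simps)
  finally have "- (a \<bullet> gradient h x) \<le> - (a \<bullet> gradient h y) + 1 / 4 * (norm a)\<^sup>2 + L\<^sup>2 * (norm (x - y))\<^sup>2"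
    by (simp add: inner_diff_right)
  moreover have "(\<integral>z. - (a \<bullet> ?G z) \<partial>uniform_sphere)
      \<le> - (a \<bullet> gradient h x) + 1 / 4 * (norm a)\<^sup>2 + ?d * u\<^sup>2 * L\<^sup>2 / 4"
    using grad_est2_bias[OF h u, of "1 / 2" a x] by simp
  ultimately have cross: "(\<integral>z. - (a \<bullet> ?G z) \<partial>uniform_sphere)
      \<le> - (a \<bullet> gradient h y) + 1 / 2 * (norm a)\<^sup>2 + (L\<^sup>2 * (norm (x - y))\<^sup>2 + ?d * u\<^sup>2 * L\<^sup>2 / 4)"
    by linarith
  have int: "integrable uniform_sphere (\<lambda>z::real^'d. F)" "integrable uniform_sphere (\<lambda>z. \<eta> * - (a \<bullet> ?G z))"
    "integrable uniform_sphere (\<lambda>z. L * \<eta>\<^sup>2 / 2 * (norm (?G z))\<^sup>2)"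
    using integrable_grad_est2[OF h u] by (auto intro!: integrable_mult_right integrable_const)
  have "(\<integral>z. F - \<eta> * (a \<bullet> ?G z) + L * \<eta>\<^sup>2 / 2 * (norm (?G z))\<^sup>2 \<partial>uniform_sphere)
      = (\<integral>z. F + \<eta> * - (a \<bullet> ?G z) + L * \<eta>\<^sup>2 / 2 * (norm (?G z))\<^sup>2 \<partial>uniform_sphere)"
    by simp
  also have "\<dots> = (\<integral>z. F \<partial>(uniform_sphere :: (real^'d) measure)) + (\<integral>z. \<eta> * - (a \<bullet> ?G z) \<partial>uniform_sphere)
        + (\<integral>z. L * \<eta>\<^sup>2 / 2 * (norm (?G z))\<^sup>2 \<partial>uniform_sphere)"
    using int by (simp only: Bochner_Integration.integral_add Bochner_Integration.integrable_add)
  also have "\<dots> = F + \<eta> * (\<integral>z. - (a \<bullet> ?G z) \<partial>uniform_sphere)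
      + L * \<eta>\<^sup>2 / 2 * (\<integral>z. (norm (?G z))\<^sup>2 \<partial>uniform_sphere)"
    using prob_space by (simp only: integral_mult_right_zero lebesgue_integral_const scaleR_one space_uniform_sphere)
  also have "\<dots> \<le> F + \<eta> * (- (a \<bullet> gradient h y) + 1 / 2 * (norm a)\<^sup>2 + (L\<^sup>2 * (norm (x - y))\<^sup>2 + ?d * u\<^sup>2 * L\<^sup>2 / 4))
      + L * \<eta>\<^sup>2 / 2 * (4 * ?d / 3 * (norm (gradient h x))\<^sup>2 + u\<^sup>2 * L\<^sup>2 * ?d\<^sup>2)"
    using cross grad_est2_second_moment[OF h u, of x] L \<eta>
    by (intro add_mono mult_left_mono) auto
  finally show ?thesis by (simp add: algebra_simps)
qed

text \<open>Here \<open>w\<close> is the deviation of one agent from the mean. Its correlation with the estimator is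
absorbed into \<open>\<theta> \<parallel>w\<parallel>\<^sup>2\<close>, at the price of \<open>1/\<theta>\<close> in front of terms of order \<open>\<eta>\<^sup>2\<close>; \<open>\<theta>\<close> is chosen later so
that the contraction by \<open>\<rho>\<^sup>2\<close> survives.\<close>

lemma expected_sq_distance_per_agent:
  fixes h :: "real^'d::finite \<Rightarrow> real"
  assumes h: "smooth_with L h" and u: "u > 0" and \<eta>: "\<eta> > 0" and \<theta>: "\<theta> > 0"
  shows "(\<integral>z. (norm (w - \<eta> *\<^sub>R grad_est2 h x u z))\<^sup>2 \<partial>uniform_sphere)
    \<le> (1 + \<theta>) * (norm w)\<^sup>2
      + \<eta>\<^sup>2 * ((4 * real CARD('d) / 3 + 2 / \<theta>) * (norm (gradient h x))\<^sup>2
          + u\<^sup>2 * L\<^sup>2 * ((real CARD('d))\<^sup>2 + real CARD('d) / (2 * \<theta>)))"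
proof -
  interpret prob_space "uniform_sphere :: (real^'d) measure" by (rule prob_space_uniform_sphere)
  let ?G = "grad_est2 h x u" and ?d = "real CARD('d)" and ?g = "gradient h x"
  have "- (w \<bullet> ?g) \<le> norm w * norm ?g"
    using Cauchy_Schwarz_ineq2[of w ?g] by simp
  then have "2 * \<eta> * - (w \<bullet> ?g) \<le> 2 * \<eta> * (norm w * norm ?g)"
    using \<eta> by (intro mult_left_mono) auto
  also have "\<dots> \<le> \<theta> / 2 * (norm w)\<^sup>2 + 2 / \<theta> * \<eta>\<^sup>2 * (norm ?g)\<^sup>2"
  proof -
    have "0 \<le> (\<theta> * norm w - 2 * \<eta> * norm ?g)\<^sup>2 / (2 * \<theta>)" using \<theta> by simp
    also have "\<dots> = \<theta> / 2 * (norm w)\<^sup>2 + 2 / \<theta> * \<eta>\<^sup>2 * (norm ?g)\<^sup>2 - 2 * \<eta> * (norm w * norm ?g)"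
      using \<theta> by (simp add: field_simps power2_eq_square)
    finally show ?thesis by simp
  qed
  finally have 1: "2 * \<eta> * - (w \<bullet> ?g) \<le> \<theta> / 2 * (norm w)\<^sup>2 + 2 / \<theta> * \<eta>\<^sup>2 * (norm ?g)\<^sup>2" .
  have "(\<integral>z. - (w \<bullet> ?G z) \<partial>uniform_sphere)
      \<le> - (w \<bullet> ?g) + \<theta> / (4 * \<eta>) * (norm w)\<^sup>2 + ?d * u\<^sup>2 * L\<^sup>2 * \<eta> / (4 * \<theta>)"
    using grad_est2_bias[OF h u, of "\<theta> / (2 * \<eta>)" w x] \<theta> \<eta> by (simp add: field_simps)
  then have "2 * \<eta> * (\<integral>z. - (w \<bullet> ?G z) \<partial>uniform_sphere)
      \<le> 2 * \<eta> * (- (w \<bullet> ?g) + \<theta> / (4 * \<eta>) * (norm w)\<^sup>2 + ?d * u\<^sup>2 * L\<^sup>2 * \<eta> / (4 * \<theta>))"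
    using \<eta> by (intro mult_left_mono) auto
  also have "\<dots> = 2 * \<eta> * - (w \<bullet> ?g) + \<theta> / 2 * (norm w)\<^sup>2 + \<eta>\<^sup>2 * (u\<^sup>2 * L\<^sup>2 * (?d / (2 * \<theta>)))"
    using \<eta> \<theta> by (simp add: field_simps power2_eq_square)
  finally have cross: "2 * \<eta> * (\<integral>z. - (w \<bullet> ?G z) \<partial>uniform_sphere)
      \<le> \<theta> * (norm w)\<^sup>2 + \<eta>\<^sup>2 * (2 / \<theta> * (norm ?g)\<^sup>2 + u\<^sup>2 * L\<^sup>2 * (?d / (2 * \<theta>)))"
    using 1 by (simp add: distrib_left mult_ac)
  have int: "integrable uniform_sphere (\<lambda>z::real^'d. (norm w)\<^sup>2)"
    "integrable uniform_sphere (\<lambda>z. 2 * \<eta> * - (w \<bullet> ?G z))"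
    "integrable uniform_sphere (\<lambda>z. \<eta>\<^sup>2 * (norm (?G z))\<^sup>2)"
    using integrable_grad_est2[OF h u] by (auto intro!: integrable_mult_right integrable_const)
  have "(norm (w - \<eta> *\<^sub>R ?G z))\<^sup>2 = (norm w)\<^sup>2 + 2 * \<eta> * - (w \<bullet> ?G z) + \<eta>\<^sup>2 * (norm (?G z))\<^sup>2" for z
    unfolding power2_norm_eq_inner by (simp add: inner_diff inner_commute power2_eq_square algebra_simps)
  then have "(\<integral>z. (norm (w - \<eta> *\<^sub>R ?G z))\<^sup>2 \<partial>uniform_sphere)
      = (\<integral>z. (norm w)\<^sup>2 + 2 * \<eta> * - (w \<bullet> ?G z) + \<eta>\<^sup>2 * (norm (?G z))\<^sup>2 \<partial>uniform_sphere)"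
    by simp
  also have "\<dots> = (\<integral>z. (norm w)\<^sup>2 \<partial>(uniform_sphere :: (real^'d) measure))
      + (\<integral>z. 2 * \<eta> * - (w \<bullet> ?G z) \<partial>uniform_sphere) + (\<integral>z. \<eta>\<^sup>2 * (norm (?G z))\<^sup>2 \<partial>uniform_sphere)"
    using int by (simp only: Bochner_Integration.integral_add Bochner_Integration.integrable_add)
  also have "\<dots> = (norm w)\<^sup>2 + 2 * \<eta> * (\<integral>z. - (w \<bullet> ?G z) \<partial>uniform_sphere)
      + \<eta>\<^sup>2 * (\<integral>z. (norm (?G z))\<^sup>2 \<partial>uniform_sphere)"
    using prob_space by (simp only: integral_mult_right_zero lebesgue_integral_const scaleR_one space_uniform_sphere)
  also have "\<dots> \<le> (norm w)\<^sup>2 + (\<theta> * (norm w)\<^sup>2 + \<eta>\<^sup>2 * (2 / \<theta> * (norm ?g)\<^sup>2 + u\<^sup>2 * L\<^sup>2 * (?d / (2 * \<theta>))))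
      + \<eta>\<^sup>2 * (4 * ?d / 3 * (norm ?g)\<^sup>2 + u\<^sup>2 * L\<^sup>2 * ?d\<^sup>2)"
    using cross grad_est2_second_moment[OF h u, of x]
    by (intro add_mono mult_left_mono) auto
  finally show ?thesis by (simp add: algebra_simps)
qed

section \<open>One round of the algorithm\<close>

definition disagreement :: "('n::finite \<Rightarrow> 'b::real_normed_vector) \<Rightarrow> real" where
  "disagreement y = agent_mean (\<lambda>i. (norm (y i - agent_mean y))\<^sup>2)"

definition mean_sq_gradient :: "('n::finite \<Rightarrow> 'b::euclidean_space \<Rightarrow> real) \<Rightarrow> ('n \<Rightarrow> 'b) \<Rightarrow> real" where
  "mean_sq_gradient fi y = agent_mean (\<lambda>i. (norm (gradient (fi i) (y i)))\<^sup>2)"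

text \<open>The local gradients need not vanish at a minimiser of the average. They are controlled by the
local gaps \<open>fi (agent_mean X) - m i\<close>, whose mean exceeds the global gap by \<open>\<Delta>\<close> when \<open>m i\<close> is the
infimum of \<open>fi i\<close>.\<close>

lemma mean_sq_gradient_le:
  fixes fi :: "'n::finite \<Rightarrow> 'b::euclidean_space \<Rightarrow> real"
  assumes smooth: "\<And>i. smooth_with L (fi i)" and L: "L > 0" and lb: "\<And>i y. m i \<le> fi i y"
  shows "mean_sq_gradient fi X
    \<le> 4 * L * (agent_mean (\<lambda>i. fi i (agent_mean X)) - agent_mean m) + 2 * L\<^sup>2 * disagreement X"
proof -
  let ?y = "agent_mean X"
  have "mean_sq_gradient fi X
      \<le> agent_mean (\<lambda>i. (4 * L) * (fi i ?y - m i) + (2 * L\<^sup>2) * (norm (X i - ?y))\<^sup>2)"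
    unfolding mean_sq_gradient_def
  proof (rule agent_mean_mono)
    fix i
    let ?g = "gradient (fi i)"
    have "(norm (?g (X i)))\<^sup>2 \<le> (norm (?g ?y) + norm (?g (X i) - ?g ?y))\<^sup>2"
      by (intro power_mono norm_triangle_sub) simp
    also have "\<dots> \<le> 2 * (norm (?g ?y))\<^sup>2 + 2 * (norm (?g (X i) - ?g ?y))\<^sup>2"
      using zero_le_power2[of "norm (?g ?y) - norm (?g (X i) - ?g ?y)"]
      by (simp add: power2_eq_square algebra_simps)
    also have "\<dots> \<le> 2 * (2 * L * (fi i ?y - m i)) + 2 * (L * norm (X i - ?y))\<^sup>2"
      using smooth_with_gradient_sq_le[OF smooth L lb, of i ?y] smooth_with_lipschitz[OF smooth, of i "X i" ?y]
      by (intro add_mono mult_left_mono power_mono) auto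
    finally show "(norm (?g (X i)))\<^sup>2 \<le> (4 * L) * (fi i ?y - m i) + (2 * L\<^sup>2) * (norm (X i - ?y))\<^sup>2"
      by (simp add: power_mult_distrib)
  qed
  then show ?thesis
    by (simp add: agent_mean_add agent_mean_cmult agent_mean_diff disagreement_def)
qed

lemma disagreement_nonneg: "0 \<le> disagreement y"
  unfolding disagreement_def by (rule agent_mean_nonneg) simp

text \<open>The state and the fresh directions of one round. Independence from the state is stated for each
direction \<open>Z i\<close> separately, as a product joint law, because all bounds are taken agent by agent.\<close>

locale zo_step = prob_space M for M :: "'w measure" +
  fixes fi :: "'n::finite \<Rightarrow> real^'d::finite \<Rightarrow> real" and W :: "real^'n^'n"
    and L u \<eta> R :: real and X :: "'w \<Rightarrow> real^'d^'n" and Z :: "'n \<Rightarrow> 'w \<Rightarrow> real^'d"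
  assumes smooth: "\<And>i. smooth_with L (fi i)" and L: "L > 0" and u: "u > 0" and \<eta>: "\<eta> > 0"
    and W: "doubly_stochastic W"
    and X_meas: "X \<in> borel_measurable M" and Z_meas: "\<And>i. Z i \<in> borel_measurable M"
    and fresh: "\<And>i. distr M borel X \<Otimes>\<^sub>M distr M borel (Z i) = distr M (borel \<Otimes>\<^sub>M borel) (\<lambda>\<omega>. (X \<omega>, Z i \<omega>))"
    and Z_unif: "\<And>i. distr M borel (Z i) = uniform_sphere"
    and X_bounded: "AE \<omega> in M. norm (X \<omega>) \<le> R"
begin

abbreviation "f \<equiv> \<lambda>y. agent_mean (\<lambda>i. fi i y)"
abbreviation "G \<equiv> \<lambda>\<omega> i. grad_est2 (fi i) (X \<omega> $ i) u (Z i \<omega>)"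
abbreviation "X' \<equiv> \<lambda>\<omega> i. \<Sum>j\<in>UNIV. W $ i $ j *\<^sub>R (X \<omega> $ j - \<eta> *\<^sub>R G \<omega> j)"
abbreviation "mean \<omega> \<equiv> agent_mean (($) (X \<omega>))"

lemma f_smooth: "smooth_with L f"
  by (rule smooth_with_agent_mean(2)[OF smooth])

lemma gradient_f: "gradient f y = agent_mean (\<lambda>i. gradient (fi i) y)"
  by (rule smooth_with_agent_mean(1)[OF smooth])

lemma continuous_mean: "continuous_on S (\<lambda>x::real^'d^'n. agent_mean (($) x))"
  unfolding agent_mean_def by (intro continuous_intros)

lemma continuous_f_mean: "continuous_on S (\<lambda>x::real^'d^'n. f (agent_mean (($) x)))"
  by (rule smooth_with_continuous_on_compose[OF f_smooth continuous_mean])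

lemma integrable_state:
  fixes \<Psi> :: "real^'d^'n \<Rightarrow> real"
  shows "continuous_on UNIV \<Psi> \<Longrightarrow> integrable M (\<lambda>\<omega>. \<Psi> (X \<omega>))"
  by (rule integrable_continuous_of_bounded[OF X_meas X_bounded])

lemma integrable_f_mean: "integrable M (\<lambda>\<omega>. f (mean \<omega>))"
  by (rule integrable_state[OF continuous_f_mean])

lemma integrable_sq_deviation: "integrable M (\<lambda>\<omega>. (norm (X \<omega> $ i - mean \<omega>))\<^sup>2)"
  using integrable_state[of "\<lambda>x. (norm (x $ i - agent_mean (($) x)))\<^sup>2"]
  by (simp add: continuous_intros continuous_mean)

lemma integrable_sq_gradient: "integrable M (\<lambda>\<omega>. (norm (gradient (fi i) (X \<omega> $ i)))\<^sup>2)"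
  by (rule integrable_state[of "\<lambda>x. (norm (gradient (fi i) (x $ i)))\<^sup>2"])
    (intro continuous_intros gradient_continuous_on_compose[OF smooth])

lemma integrable_disagreement: "integrable M (\<lambda>\<omega>. disagreement (($) (X \<omega>)))"
  unfolding disagreement_def by (intro integral_agent_mean(1) integrable_sq_deviation)

lemma integrable_mean_sq_gradient: "integrable M (\<lambda>\<omega>. mean_sq_gradient fi (($) (X \<omega>)))"
  unfolding mean_sq_gradient_def by (intro integral_agent_mean(1) integrable_sq_gradient)

lemma integrable_sq_gradient_f: "integrable M (\<lambda>\<omega>. (norm (gradient f (mean \<omega>)))\<^sup>2)"
  by (rule integrable_state[of "\<lambda>x. (norm (gradient f (agent_mean (($) x))))\<^sup>2"])
    (intro continuous_intros gradient_continuous_on_compose[OF f_smooth] continuous_mean)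

text \<open>The descent inequality is applied to the mean iterate, on which mixing has no effect. Replacing
\<open>\<parallel>agent_mean G\<parallel>\<^sup>2\<close> by the mean of \<open>\<parallel>G i\<parallel>\<^sup>2\<close> makes the bound a mean of terms each depending on one
direction.\<close>

lemma expected_objective_step:
  assumes int': "integrable M (\<lambda>\<omega>. f (agent_mean (X' \<omega>)))"
  shows "expectation (\<lambda>\<omega>. f (agent_mean (X' \<omega>)))
    \<le> expectation (\<lambda>\<omega>. f (mean \<omega>)) - \<eta> / 2 * expectation (\<lambda>\<omega>. (norm (gradient f (mean \<omega>)))\<^sup>2)
      + \<eta> * (L\<^sup>2 * expectation (\<lambda>\<omega>. disagreement (($) (X \<omega>))) + real CARD('d) * u\<^sup>2 * L\<^sup>2 / 4)
      + L * \<eta>\<^sup>2 / 2 * (4 * real CARD('d) / 3 * expectation (\<lambda>\<omega>. mean_sq_gradient fi (($) (X \<omega>))) + u\<^sup>2 * L\<^sup>2 * (real CARD('d))\<^sup>2)"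
proof -
  define \<Phi> where "\<Phi> i x z = f (agent_mean (($) x)) - \<eta> * (gradient f (agent_mean (($) x)) \<bullet> grad_est2 (fi i) (x $ i) u z)
    + L * \<eta>\<^sup>2 / 2 * (norm (grad_est2 (fi i) (x $ i) u z))\<^sup>2" for i and x :: "real^'d^'n" and z
  define \<psi> where "\<psi> i x = f (agent_mean (($) x))
      - \<eta> * (gradient f (agent_mean (($) x)) \<bullet> gradient (fi i) (agent_mean (($) x)))
      + \<eta> / 2 * (norm (gradient f (agent_mean (($) x))))\<^sup>2
      + \<eta> * (L\<^sup>2 * (norm (x $ i - agent_mean (($) x)))\<^sup>2 + real CARD('d) * u\<^sup>2 * L\<^sup>2 / 4)
      + L * \<eta>\<^sup>2 / 2 * (4 * real CARD('d) / 3 * (norm (gradient (fi i) (x $ i)))\<^sup>2 + u\<^sup>2 * L\<^sup>2 * (real CARD('d))\<^sup>2)"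
    for i and x :: "real^'d^'n"
  have c\<Phi>: "continuous_on UNIV (\<lambda>p. \<Phi> i (fst p) (snd p))" for i
  proof -
    have m: "continuous_on UNIV (\<lambda>p::(real^'d^'n) \<times> (real^'d). agent_mean (($) (fst p)))"
      unfolding agent_mean_def by (intro continuous_intros)
    show ?thesis
      unfolding \<Phi>_def
      by (intro continuous_intros smooth_with_continuous_on_compose[OF f_smooth m]
          gradient_continuous_on_compose[OF f_smooth m] grad_est2_continuous_on[OF smooth])
  qed
  have c\<psi>: "continuous_on UNIV (\<psi> i)" for i
    unfolding \<psi>_def
    by (intro continuous_intros continuous_f_mean continuous_mean gradient_continuous_on_compose[OF f_smooth continuous_mean]
        gradient_continuous_on_compose[OF smooth continuous_mean]
        gradient_continuous_on_compose[OF smooth, where g = "\<lambda>x. x $ i"])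
  have le: "(\<integral>z. \<Phi> i x z \<partial>uniform_sphere) \<le> \<psi> i x" for i x
    unfolding \<Phi>_def \<psi>_def by (rule expected_descent_per_agent[OF smooth L u \<eta>])
  note sample = continuous_expectation_le_of_fresh_sample[OF X_meas Z_meas fresh Z_unif X_bounded c\<Phi> c\<psi> le]
  have path: "f (agent_mean (X' \<omega>)) \<le> agent_mean (\<lambda>i. \<Phi> i (X \<omega>) (Z i \<omega>))" for \<omega>
  proof -
    let ?y = "mean \<omega>" and ?g = "agent_mean (G \<omega>)"
    have "agent_mean (X' \<omega>) = ?y + - (\<eta> *\<^sub>R ?g)"
      by (simp add: agent_mean_mixing[OF W] agent_mean_diff agent_mean_scaleR)
    then have "f (agent_mean (X' \<omega>)) \<le> f ?y + gradient f ?y \<bullet> (- (\<eta> *\<^sub>R ?g)) + L / 2 * (norm (- (\<eta> *\<^sub>R ?g)))\<^sup>2"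
      using smooth_with_quadratic_upper[OF f_smooth, of ?y "- (\<eta> *\<^sub>R ?g)"] by simp
    also have "\<dots> = f ?y - \<eta> * (gradient f ?y \<bullet> ?g) + L * \<eta>\<^sup>2 / 2 * (norm ?g)\<^sup>2"
      by (simp add: power_mult_distrib)
    also have "\<dots> \<le> f ?y - \<eta> * (gradient f ?y \<bullet> ?g) + L * \<eta>\<^sup>2 / 2 * agent_mean (\<lambda>i. (norm (G \<omega> i))\<^sup>2)"
      using L by (intro add_left_mono mult_left_mono norm_agent_mean_sq_le) auto
    also have "\<dots> = agent_mean (\<lambda>i. \<Phi> i (X \<omega>) (Z i \<omega>))"
      by (simp only: \<Phi>_def agent_mean_add agent_mean_diff agent_mean_cmult agent_mean_inner agent_mean_const)
    finally show ?thesis .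
  qed
  have avg: "agent_mean (\<lambda>i. \<psi> i x) = f (agent_mean (($) x)) - \<eta> / 2 * (norm (gradient f (agent_mean (($) x))))\<^sup>2
      + \<eta> * (L\<^sup>2 * disagreement (($) x) + real CARD('d) * u\<^sup>2 * L\<^sup>2 / 4)
      + L * \<eta>\<^sup>2 / 2 * (4 * real CARD('d) / 3 * mean_sq_gradient fi (($) x) + u\<^sup>2 * L\<^sup>2 * (real CARD('d))\<^sup>2)" for x
  proof -
    have "agent_mean (\<lambda>i. \<psi> i x) = f (agent_mean (($) x))
      - \<eta> * (gradient f (agent_mean (($) x)) \<bullet> gradient f (agent_mean (($) x)))
      + \<eta> / 2 * (norm (gradient f (agent_mean (($) x))))\<^sup>2
      + \<eta> * (L\<^sup>2 * disagreement (($) x) + real CARD('d) * u\<^sup>2 * L\<^sup>2 / 4)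
      + L * \<eta>\<^sup>2 / 2 * (4 * real CARD('d) / 3 * mean_sq_gradient fi (($) x) + u\<^sup>2 * L\<^sup>2 * (real CARD('d))\<^sup>2)"
      unfolding \<psi>_def disagreement_def mean_sq_gradient_def gradient_f[of "agent_mean (($) x)"]
      by (simp only: agent_mean_add agent_mean_diff agent_mean_cmult agent_mean_inner agent_mean_const)
    then show ?thesis by (simp add: power2_norm_eq_inner)
  qed
  have "expectation (\<lambda>\<omega>. f (agent_mean (X' \<omega>))) \<le> expectation (\<lambda>\<omega>. agent_mean (\<lambda>i. \<Phi> i (X \<omega>) (Z i \<omega>)))"
    by (intro integral_mono int' path integral_agent_mean(1) sample(1))
  also have "\<dots> = agent_mean (\<lambda>i. expectation (\<lambda>\<omega>. \<Phi> i (X \<omega>) (Z i \<omega>)))"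
    by (intro integral_agent_mean(2) sample(1))
  also have "\<dots> \<le> agent_mean (\<lambda>i. expectation (\<lambda>\<omega>. \<psi> i (X \<omega>)))"
    by (intro agent_mean_mono sample(3))
  also have "\<dots> = expectation (\<lambda>\<omega>. agent_mean (\<lambda>i. \<psi> i (X \<omega>)))"
    by (intro integral_agent_mean(2)[symmetric] sample(2))
  also have "\<dots> = expectation (\<lambda>\<omega>. f (mean \<omega>)) - \<eta> / 2 * expectation (\<lambda>\<omega>. (norm (gradient f (mean \<omega>)))\<^sup>2)
      + \<eta> * (L\<^sup>2 * expectation (\<lambda>\<omega>. disagreement (($) (X \<omega>))) + real CARD('d) * u\<^sup>2 * L\<^sup>2 / 4)
      + L * \<eta>\<^sup>2 / 2 * (4 * real CARD('d) / 3 * expectation (\<lambda>\<omega>. mean_sq_gradient fi (($) (X \<omega>))) + u\<^sup>2 * L\<^sup>2 * (real CARD('d))\<^sup>2)"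
    unfolding avg
    using integrable_f_mean integrable_sq_gradient_f integrable_disagreement integrable_mean_sq_gradient
    by (simp add: prob_space)
  finally show ?thesis .
qed

lemma expected_disagreement_step:
  assumes int': "integrable M (\<lambda>\<omega>. disagreement (X' \<omega>))" and \<theta>: "\<theta> > 0"
  shows "expectation (\<lambda>\<omega>. disagreement (X' \<omega>))
    \<le> (consensus_rate W)\<^sup>2 * ((1 + \<theta>) * expectation (\<lambda>\<omega>. disagreement (($) (X \<omega>)))
      + \<eta>\<^sup>2 * ((4 * real CARD('d) / 3 + 2 / \<theta>) * expectation (\<lambda>\<omega>. mean_sq_gradient fi (($) (X \<omega>)))
        + u\<^sup>2 * L\<^sup>2 * ((real CARD('d))\<^sup>2 + real CARD('d) / (2 * \<theta>))))"
proof -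
  define \<Phi> where "\<Phi> i x z = (norm ((x $ i - agent_mean (($) x)) - \<eta> *\<^sub>R grad_est2 (fi i) (x $ i) u z))\<^sup>2"
    for i and x :: "real^'d^'n" and z
  define \<psi> where "\<psi> i x = (1 + \<theta>) * (norm (x $ i - agent_mean (($) x)))\<^sup>2
      + \<eta>\<^sup>2 * ((4 * real CARD('d) / 3 + 2 / \<theta>) * (norm (gradient (fi i) (x $ i)))\<^sup>2 + u\<^sup>2 * L\<^sup>2 * ((real CARD('d))\<^sup>2 + real CARD('d) / (2 * \<theta>)))"
    for i and x :: "real^'d^'n"
  have c\<Phi>: "continuous_on UNIV (\<lambda>p. \<Phi> i (fst p) (snd p))" for i
  proof -
    have m: "continuous_on UNIV (\<lambda>p::(real^'d^'n) \<times> (real^'d). agent_mean (($) (fst p)))"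
      unfolding agent_mean_def by (intro continuous_intros)
    show ?thesis
      unfolding \<Phi>_def by (intro continuous_intros grad_est2_continuous_on[OF smooth] m)
  qed
  have c\<psi>: "continuous_on UNIV (\<psi> i)" for i
    unfolding \<psi>_def
    by (intro continuous_intros gradient_continuous_on_compose[OF smooth, where g = "\<lambda>x. x $ i"] continuous_mean)
  have le: "(\<integral>z. \<Phi> i x z \<partial>uniform_sphere) \<le> \<psi> i x" for i x
    unfolding \<Phi>_def \<psi>_def by (rule expected_sq_distance_per_agent[OF smooth u \<eta> \<theta>])
  note sample = continuous_expectation_le_of_fresh_sample[OF X_meas Z_meas fresh Z_unif X_bounded c\<Phi> c\<psi> le]
  have path: "disagreement (X' \<omega>) \<le> (consensus_rate W)\<^sup>2 * agent_mean (\<lambda>i. \<Phi> i (X \<omega>) (Z i \<omega>))" for \<omega>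
  proof -
    have "(\<lambda>j. (norm (X \<omega> $ j - \<eta> *\<^sub>R G \<omega> j - mean \<omega>))\<^sup>2) = (\<lambda>i. \<Phi> i (X \<omega>) (Z i \<omega>))"
      by (simp add: \<Phi>_def algebra_simps)
    then show ?thesis
      using mixing_contracts_disagreement[OF W, of "\<lambda>j. X \<omega> $ j - \<eta> *\<^sub>R G \<omega> j" "mean \<omega>"]
      by (simp add: disagreement_def agent_mean_mixing[OF W])
  qed
  have "expectation (\<lambda>\<omega>. disagreement (X' \<omega>))
      \<le> expectation (\<lambda>\<omega>. (consensus_rate W)\<^sup>2 * agent_mean (\<lambda>i. \<Phi> i (X \<omega>) (Z i \<omega>)))"
    by (intro integral_mono int' path integral_agent_mean(1) sample(1) integrable_mult_right)
  also have "\<dots> = (consensus_rate W)\<^sup>2 * expectation (\<lambda>\<omega>. agent_mean (\<lambda>i. \<Phi> i (X \<omega>) (Z i \<omega>)))"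
    by simp
  also have "expectation (\<lambda>\<omega>. agent_mean (\<lambda>i. \<Phi> i (X \<omega>) (Z i \<omega>))) = agent_mean (\<lambda>i. expectation (\<lambda>\<omega>. \<Phi> i (X \<omega>) (Z i \<omega>)))"
    by (intro integral_agent_mean(2) sample(1))
  also have "(consensus_rate W)\<^sup>2 * \<dots> \<le> (consensus_rate W)\<^sup>2 * agent_mean (\<lambda>i. expectation (\<lambda>\<omega>. \<psi> i (X \<omega>)))"
    by (intro mult_left_mono agent_mean_mono sample(3)) simp
  also have "agent_mean (\<lambda>i. expectation (\<lambda>\<omega>. \<psi> i (X \<omega>))) = expectation (\<lambda>\<omega>. agent_mean (\<lambda>i. \<psi> i (X \<omega>)))"
    by (intro integral_agent_mean(2)[symmetric] sample(2))
  also have "\<dots> = (1 + \<theta>) * expectation (\<lambda>\<omega>. disagreement (($) (X \<omega>)))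
      + \<eta>\<^sup>2 * ((4 * real CARD('d) / 3 + 2 / \<theta>) * expectation (\<lambda>\<omega>. mean_sq_gradient fi (($) (X \<omega>)))
        + u\<^sup>2 * L\<^sup>2 * ((real CARD('d))\<^sup>2 + real CARD('d) / (2 * \<theta>)))"
  proof -
    have "agent_mean (\<lambda>i. \<psi> i x) = (1 + \<theta>) * disagreement (($) x)
      + \<eta>\<^sup>2 * ((4 * real CARD('d) / 3 + 2 / \<theta>) * mean_sq_gradient fi (($) x) + u\<^sup>2 * L\<^sup>2 * ((real CARD('d))\<^sup>2 + real CARD('d) / (2 * \<theta>)))" for x
      unfolding \<psi>_def disagreement_def mean_sq_gradient_def
      by (simp only: agent_mean_add agent_mean_cmult agent_mean_const)
    then show ?thesis
      using integrable_disagreement integrable_mean_sq_gradient by (simp add: prob_space)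
  qed
  finally show ?thesis .
qed

lemma expected_mean_sq_gradient_le:
  assumes lb: "\<And>i y. m i \<le> fi i y"
  shows "expectation (\<lambda>\<omega>. mean_sq_gradient fi (($) (X \<omega>)))
    \<le> 4 * L * (expectation (\<lambda>\<omega>. f (mean \<omega>)) - agent_mean m)
      + 2 * L\<^sup>2 * expectation (\<lambda>\<omega>. disagreement (($) (X \<omega>)))"
proof -
  have "expectation (\<lambda>\<omega>. mean_sq_gradient fi (($) (X \<omega>)))
      \<le> expectation (\<lambda>\<omega>. 4 * L * (f (mean \<omega>) - agent_mean m) + 2 * L\<^sup>2 * disagreement (($) (X \<omega>)))"
    using integrable_f_mean integrable_disagreement
    by (intro integral_mono integrable_mean_sq_gradient mean_sq_gradient_le[OF smooth L lb]) auto
  also have "\<dots> = 4 * L * (expectation (\<lambda>\<omega>. f (mean \<omega>)) - agent_mean m)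
      + 2 * L\<^sup>2 * expectation (\<lambda>\<omega>. disagreement (($) (X \<omega>)))"
    using integrable_f_mean integrable_disagreement by (simp add: prob_space)
  finally show ?thesis .
qed

end

section \<open>Iterates as functions of past directions\<close>

lemma zo_iter_cong:
  assumes "\<And>s j. 1 \<le> s \<Longrightarrow> s \<le> t \<Longrightarrow> z s j = z' s j"
  shows "zo_iter W fi \<eta> u x0 z t = zo_iter W fi \<eta> u x0 z' t"
  using assms by (induction t) auto

lemma zo_iter_measurable:
  fixes fi :: "'n::finite \<Rightarrow> real^'d::finite \<Rightarrow> real"
  assumes smooth: "\<And>i. smooth_with L (fi i)" and A: "{1..t} \<times> UNIV \<subseteq> A"
  shows "(\<lambda>p. zo_iter W fi \<eta> u x0 (\<lambda>s j. p (s, j)) t i) \<in> borel_measurable (PiM A (\<lambda>_. borel))"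
  using A
proof (induction t arbitrary: i)
  case (Suc t)
  have IH: "(\<lambda>p. zo_iter W fi \<eta> u x0 (\<lambda>s j. p (s, j)) t i) \<in> borel_measurable (PiM A (\<lambda>_. borel))" for i
    using Suc.prems by (intro Suc.IH) auto
  have "(\<lambda>p. p (Suc t, j)) \<in> borel_measurable (PiM A (\<lambda>_. borel))" for j
    using Suc.prems by (intro measurable_component_singleton) auto
  then have G: "(\<lambda>p. grad_est2 (fi j) (zo_iter W fi \<eta> u x0 (\<lambda>s j. p (s, j)) t j) (u (Suc t)) (p (Suc t, j)))
      \<in> borel_measurable (PiM A (\<lambda>_. borel))" for j
    by (intro grad_est2_measurable[OF smooth] IH)
  show ?case
    unfolding zo_iter.simps
    by (intro borel_measurable_sum borel_measurable_scaleR borel_measurable_const borel_measurable_diff IH G)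
qed simp

text \<open>The bound is uniform over all choices of unit directions: \<open>\<parallel>grad_est2\<parallel>\<close> grows at most linearly
with the iterate because gradients are Lipschitz.\<close>

lemma zo_iter_bounded:
  fixes fi :: "'n::finite \<Rightarrow> real^'d::finite \<Rightarrow> real"
  assumes smooth: "\<And>i. smooth_with L (fi i)" and L: "L > 0" and u: "\<And>t. t \<ge> 1 \<Longrightarrow> u t > 0"
  shows "\<exists>B. \<forall>z. (\<forall>s\<ge>1. \<forall>j. norm (z s j) = 1) \<longrightarrow> (\<forall>i. norm (zo_iter W fi \<eta> u x0 z t i) \<le> B)"
proof (induction t)
  case 0
  show ?case
    by (intro exI[of _ "\<Sum>i\<in>UNIV. norm (x0 i)"]) (auto intro: member_le_sum)
next
  case (Suc t)
  then obtain B where B: "\<And>z i. (\<forall>s\<ge>1. \<forall>j. norm (z s j) = 1) \<Longrightarrow> norm (zo_iter W fi \<eta> u x0 z t i) \<le> B"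
    by blast
  define g where "g j = real CARD('d) * (norm (gradient (fi j) 0) + L * B + L * u (Suc t) / 2)" for j
  define C where "C i = (\<Sum>j\<in>UNIV. \<bar>W $ i $ j\<bar> * (B + \<bar>\<eta> (Suc t)\<bar> * g j))" for i
  have step: "norm (zo_iter W fi \<eta> u x0 z (Suc t) i) \<le> C i" if z: "\<forall>s\<ge>1. \<forall>j. norm (z s j) = 1" for z i
  proof -
    let ?x = "zo_iter W fi \<eta> u x0 z t"
    let ?G = "\<lambda>j. grad_est2 (fi j) (?x j) (u (Suc t)) (z (Suc t) j)"
    have G: "norm (?G j) \<le> g j" for j
    proof -
      have "norm (gradient (fi j) (?x j)) \<le> norm (gradient (fi j) 0) + norm (gradient (fi j) (?x j) - gradient (fi j) 0)"
        by (rule norm_triangle_sub)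
      also have "\<dots> \<le> norm (gradient (fi j) 0) + L * norm (?x j - 0)"
        by (intro add_left_mono smooth_with_lipschitz[OF smooth])
      also have "\<dots> \<le> norm (gradient (fi j) 0) + L * B"
        using B[OF z, of j] L by simp
      finally have "real CARD('d) * (norm (gradient (fi j) (?x j)) + L * u (Suc t) / 2) \<le> g j"
        unfolding g_def by (intro mult_left_mono) auto
      then show ?thesis
        using norm_grad_est2_le[OF smooth u, of "Suc t" "z (Suc t) j" j "?x j"] z by simp
    qed
    have "norm (zo_iter W fi \<eta> u x0 z (Suc t) i) \<le> (\<Sum>j\<in>UNIV. norm (W $ i $ j *\<^sub>R (?x j - \<eta> (Suc t) *\<^sub>R ?G j)))"
      unfolding zo_iter.simps by (rule norm_sum)
    also have "\<dots> \<le> C i"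
      unfolding C_def norm_scaleR
    proof (intro sum_mono mult_left_mono)
      fix j
      have "norm (?x j - \<eta> (Suc t) *\<^sub>R ?G j) \<le> norm (?x j) + \<bar>\<eta> (Suc t)\<bar> * norm (?G j)"
        using norm_triangle_ineq4[of "?x j" "\<eta> (Suc t) *\<^sub>R ?G j"] by simp
      also have "\<dots> \<le> B + \<bar>\<eta> (Suc t)\<bar> * g j"
        using B[OF z, of j] G[of j] by (intro add_mono mult_left_mono) auto
      finally show "norm (?x j - \<eta> (Suc t) *\<^sub>R ?G j) \<le> B + \<bar>\<eta> (Suc t)\<bar> * g j" .
    qed auto
    finally show ?thesis .
  qed
  have "norm (zo_iter W fi \<eta> u x0 z (Suc t) i) \<le> (\<Sum>i\<in>UNIV. \<bar>C i\<bar>)"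
    if "\<forall>s\<ge>1. \<forall>j. norm (z s j) = 1" for z i
    using step[OF that, of i] member_le_sum[of i UNIV "\<lambda>i. \<bar>C i\<bar>"] by simp
  then show ?case by blast
qed

text \<open>The state at time \<open>t\<close> depends on the directions of rounds \<open>1\<close> to \<open>t\<close> only, which are jointly
independent of any single direction of the next round.\<close>

lemma (in prob_space) zo_iter_fresh_sample:
  fixes W :: "real^'n^'n" and \<eta> u :: "nat \<Rightarrow> real" and x0 :: "'n \<Rightarrow> real^'d"
    and fi :: "'n::finite \<Rightarrow> real^'d::finite \<Rightarrow> real" and z :: "nat \<Rightarrow> 'n \<Rightarrow> 'a \<Rightarrow> real^'d"
  assumes smooth: "\<And>i. smooth_with L (fi i)"
    and indep: "indep_vars (\<lambda>_. borel) (\<lambda>(t, i). z t i) ({1..} \<times> UNIV)"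
  defines "X \<equiv> \<lambda>t \<omega>. (\<chi> i. zo_iter W fi \<eta> u x0 (\<lambda>s j. z s j \<omega>) t i) :: real^'d^'n"
  shows "X t \<in> borel_measurable M"
    and "distr M borel (X t) \<Otimes>\<^sub>M distr M borel (z (Suc t) i)
      = distr M (borel \<Otimes>\<^sub>M borel) (\<lambda>\<omega>. (X t \<omega>, z (Suc t) i \<omega>))"
proof -
  let ?A = "{1..t} \<times> (UNIV :: 'n set)" and ?B = "{(Suc t, i)}"
  let ?PA = "PiM ?A (\<lambda>_. borel :: (real^'d) measure)" and ?PB = "PiM ?B (\<lambda>_. borel :: (real^'d) measure)"
  define ZA where "ZA = (\<lambda>\<omega>. \<lambda>k\<in>?A. (case k of (t, i) \<Rightarrow> z t i) \<omega>)"
  define ZB where "ZB = (\<lambda>\<omega>. \<lambda>k\<in>?B. (case k of (t, i) \<Rightarrow> z t i) \<omega>)"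
  define F where "F = (\<lambda>p. (\<chi> i. zo_iter W fi \<eta> u x0 (\<lambda>s j. p (s, j)) t i) :: real^'d^'n)"
  have iv: "indep_var ?PA ZA ?PB ZB"
    unfolding ZA_def ZB_def by (rule indep_var_restrict[OF indep]) auto
  then have mA: "ZA \<in> measurable M ?PA" and mB: "ZB \<in> measurable M ?PB"
    and joint: "distr M ?PA ZA \<Otimes>\<^sub>M distr M ?PB ZB = distr M (?PA \<Otimes>\<^sub>M ?PB) (\<lambda>\<omega>. (ZA \<omega>, ZB \<omega>))"
    by (auto simp: indep_var_distribution_eq)
  have comp: "(\<lambda>p. F p $ k) \<in> borel_measurable ?PA" for k
    unfolding F_def vec_lambda_beta by (rule zo_iter_measurable[OF smooth]) simp
  have "F = (\<lambda>p. \<Sum>k\<in>UNIV. axis k (F p $ k))"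
    by (auto simp: vec_eq_iff axis_def if_distrib cong: if_cong)
  moreover have "(\<lambda>p. \<Sum>k\<in>UNIV. (axis k (F p $ k) :: real^'d^'n)) \<in> borel_measurable ?PA"
  proof (rule borel_measurable_sum)
    fix k :: 'n
    have "continuous_on UNIV (\<lambda>v. axis k v :: real^'d^'n)"
      unfolding axis_def
    proof (rule continuous_on_vec_lambda)
      show "continuous_on UNIV (\<lambda>v. if i = k then v else 0 :: real^'d)" for i
        by (cases "i = k") simp_all
    qed
    then show "(\<lambda>p. (axis k (F p $ k) :: real^'d^'n)) \<in> borel_measurable ?PA"
      using measurable_compose[OF comp borel_measurable_continuous_onI] by blast
  qed
  ultimately have mF: "F \<in> measurable ?PA borel" by simp
  have mG: "(\<lambda>p. p (Suc t, i)) \<in> measurable ?PB borel"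
    by (rule measurable_component_singleton) simp
  have XF: "X t = (\<lambda>\<omega>. F (ZA \<omega>))"
  proof
    fix \<omega>
    have "zo_iter W fi \<eta> u x0 (\<lambda>s j. z s j \<omega>) t = zo_iter W fi \<eta> u x0 (\<lambda>s j. ZA \<omega> (s, j)) t"
      by (rule zo_iter_cong) (simp add: ZA_def)
    then show "X t \<omega> = F (ZA \<omega>)" by (simp add: X_def F_def)
  qed
  have zG: "z (Suc t) i = (\<lambda>\<omega>. ZB \<omega> (Suc t, i))"
    by (simp add: ZB_def)
  show "X t \<in> borel_measurable M"
    unfolding XF using measurable_compose[OF mA mF] .
  interpret PB: prob_space "distr M borel (z (Suc t) i)"
    unfolding zG by (intro prob_space_distr measurable_compose[OF mB mG])
  have "distr M borel (X t) \<Otimes>\<^sub>M distr M borel (z (Suc t) i)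
      = distr (distr M ?PA ZA) borel F \<Otimes>\<^sub>M distr (distr M ?PB ZB) borel (\<lambda>p. p (Suc t, i))"
    unfolding XF zG using mA mB mF mG by (simp add: distr_distr comp_def)
  also have "\<dots> = distr (distr M ?PA ZA \<Otimes>\<^sub>M distr M ?PB ZB) (borel \<Otimes>\<^sub>M borel) (\<lambda>(p, q). (F p, q (Suc t, i)))"
  proof (rule pair_measure_distr)
    show "sigma_finite_measure (distr (distr M ?PB ZB) borel (\<lambda>p. p (Suc t, i)))"
      using PB.sigma_finite_measure_axioms mB mG unfolding zG by (simp add: distr_distr comp_def)
  qed (use mF mG in simp_all)
  also have "\<dots> = distr M (borel \<Otimes>\<^sub>M borel) (\<lambda>\<omega>. (X t \<omega>, z (Suc t) i \<omega>))"
    unfolding joint XF zG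
  proof (subst distr_distr)
    show "(\<lambda>(p, q). (F p, q (Suc t, i))) \<in> ?PA \<Otimes>\<^sub>M ?PB \<rightarrow>\<^sub>M borel \<Otimes>\<^sub>M borel"
      unfolding case_prod_beta'
      by (intro measurable_Pair measurable_compose[OF measurable_fst mF] measurable_compose[OF measurable_snd mG])
    show "(\<lambda>\<omega>. (ZA \<omega>, ZB \<omega>)) \<in> M \<rightarrow>\<^sub>M ?PA \<Otimes>\<^sub>M ?PB"
      using mA mB by simp
  qed (simp add: comp_def)
  finally show "distr M borel (X t) \<Otimes>\<^sub>M distr M borel (z (Suc t) i)
      = distr M (borel \<Otimes>\<^sub>M borel) (\<lambda>\<omega>. (X t \<omega>, z (Suc t) i \<omega>))" .
qed

section \<open>Recursions along a run, and their rates\<close>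

text \<open>The schedules stay general here and are specialised only when the recursions are solved.\<close>

locale zo_run = prob_space M for M :: "'w measure" +
  fixes fi :: "'n::finite \<Rightarrow> real^'d::finite \<Rightarrow> real" and W :: "real^'n^'n"
    and L :: real and u \<eta> :: "nat \<Rightarrow> real" and x0 :: "'n \<Rightarrow> real^'d"
    and z :: "nat \<Rightarrow> 'n \<Rightarrow> 'w \<Rightarrow> real^'d"
  assumes smooth: "\<And>i. smooth_with L (fi i)" and L: "L > 0"
    and u: "\<And>t. t \<ge> 1 \<Longrightarrow> u t > 0" and \<eta>: "\<And>t. t \<ge> 1 \<Longrightarrow> \<eta> t > 0"
    and W: "doubly_stochastic W"
    and z_indep: "indep_vars (\<lambda>_. borel) (\<lambda>(t, i). z t i) ({1..} \<times> UNIV)"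
    and z_unif: "\<And>t i. t \<ge> 1 \<Longrightarrow> distr M borel (z t i) = uniform_sphere"
begin

abbreviation "f \<equiv> \<lambda>y. agent_mean (\<lambda>i. fi i y)"
abbreviation "x t \<omega> \<equiv> zo_iter W fi \<eta> u x0 (\<lambda>s j. z s j \<omega>) t"
abbreviation "mean_objective t \<equiv> expectation (\<lambda>\<omega>. f (agent_mean (x t \<omega>)))"
abbreviation "mean_disagreement t \<equiv> expectation (\<lambda>\<omega>. disagreement (x t \<omega>))"

definition X :: "nat \<Rightarrow> 'w \<Rightarrow> real^'d^'n" where
  "X t \<omega> = (\<chi> i. x t \<omega> i)"

lemma X_nth [simp]: "X t \<omega> $ i = x t \<omega> i" "($) (X t \<omega>) = x t \<omega>"
  by (auto simp: X_def)

lemma z_measurable: "t \<ge> 1 \<Longrightarrow> z t i \<in> borel_measurable M"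
  using z_indep by (auto simp: indep_vars_def)

lemma X_bounded: "\<exists>R. AE \<omega> in M. norm (X t \<omega>) \<le> R"
proof -
  obtain B where B: "\<And>z i. (\<forall>s\<ge>1. \<forall>j. norm (z s j) = 1) \<Longrightarrow> norm (zo_iter W fi \<eta> u x0 z t i) \<le> B"
    using zo_iter_bounded[where fi=fi and u=u and W=W and \<eta>=\<eta> and ?x0.0=x0 and t=t, OF smooth L u] by blast
  have "AE \<omega> in M. norm (z s j \<omega>) = 1" if "s \<ge> 1" for s j
  proof -
    have "AE v in distr M borel (z s j). norm v = 1"
      unfolding z_unif[OF that] by (rule AE_uniform_sphere)
    then show ?thesis using z_measurable[OF that] by (subst (asm) AE_distr_iff) auto
  qed
  then have "AE \<omega> in M. \<forall>s. s \<ge> 1 \<longrightarrow> (\<forall>j. norm (z s j \<omega>) = 1)"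
    unfolding AE_all_countable by (auto intro: eventually_all_finite)
  then have "AE \<omega> in M. norm (X t \<omega>) \<le> (\<Sum>i\<in>(UNIV :: 'n set). B)"
  proof eventually_elim
    case (elim \<omega>)
    have "norm (X t \<omega>) \<le> (\<Sum>i\<in>UNIV. norm (X t \<omega> $ i))"
      unfolding norm_vec_def by (rule L2_set_le_sum) simp
    also have "\<dots> \<le> (\<Sum>i\<in>(UNIV :: 'n set). B)"
      using elim by (intro sum_mono) (simp add: B)
    finally show ?case .
  qed
  then show ?thesis by blast
qed

lemma one_step: "\<exists>R. zo_step M fi W L (u (Suc t)) (\<eta> (Suc t)) R (X t) (z (Suc t))"
proof -
  obtain R where R: "AE \<omega> in M. norm (X t \<omega>) \<le> R" using X_bounded by blast
  have "zo_step M fi W L (u (Suc t)) (\<eta> (Suc t)) R (X t) (z (Suc t))"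
    using smooth L W R z_measurable z_unif u \<eta>
      zo_iter_fresh_sample[OF smooth z_indep, where W=W and \<eta>=\<eta> and u=u and ?x0.0=x0 and t=t]
    by unfold_locales (auto simp: X_def[abs_def])
  then show ?thesis ..
qed

lemma integrable_objective: "integrable M (\<lambda>\<omega>. f (agent_mean (x t \<omega>)))"
  and integrable_deviation: "integrable M (\<lambda>\<omega>. (norm (x t \<omega> i - agent_mean (x t \<omega>)))\<^sup>2)"
  and integrable_disagreement: "integrable M (\<lambda>\<omega>. disagreement (x t \<omega>))"
proof -
  obtain R where "zo_step M fi W L (u (Suc t)) (\<eta> (Suc t)) R (X t) (z (Suc t))"
    using one_step by blast
  then interpret S: zo_step M fi W L "u (Suc t)" "\<eta> (Suc t)" R "X t" "z (Suc t)" .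
  show "integrable M (\<lambda>\<omega>. f (agent_mean (x t \<omega>)))" using S.integrable_f_mean by simp
  show "integrable M (\<lambda>\<omega>. (norm (x t \<omega> i - agent_mean (x t \<omega>)))\<^sup>2)"
    using S.integrable_sq_deviation[of i] by simp
  show "integrable M (\<lambda>\<omega>. disagreement (x t \<omega>))" using S.integrable_disagreement by simp
qed

lemma objective_recursion:
  assumes lb: "\<And>i y. m i \<le> fi i y" and PL: "\<And>y. 2 * \<mu> * (f y - f_star) \<le> (norm (gradient f y))\<^sup>2"
  shows "mean_objective (Suc t) - f_star
    \<le> (1 - \<mu> * \<eta> (Suc t)) * (mean_objective t - f_star)
      + \<eta> (Suc t) * (L\<^sup>2 * mean_disagreement t + real CARD('d) * (u (Suc t))\<^sup>2 * L\<^sup>2 / 4)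
      + L * (\<eta> (Suc t))\<^sup>2 / 2 * (4 * real CARD('d) / 3
          * (4 * L * ((mean_objective t - f_star) + (f_star - agent_mean m)) + 2 * L\<^sup>2 * mean_disagreement t)
        + (u (Suc t))\<^sup>2 * L\<^sup>2 * (real CARD('d))\<^sup>2)"
proof -
  obtain R where "zo_step M fi W L (u (Suc t)) (\<eta> (Suc t)) R (X t) (z (Suc t))"
    using one_step by blast
  then interpret S: zo_step M fi W L "u (Suc t)" "\<eta> (Suc t)" R "X t" "z (Suc t)" .
  let ?\<eta> = "\<eta> (Suc t)" and ?u = "u (Suc t)" and ?d = "real CARD('d)"
  let ?N = "expectation (\<lambda>\<omega>. (norm (gradient f (agent_mean (x t \<omega>))))\<^sup>2)"
  let ?S = "expectation (\<lambda>\<omega>. mean_sq_gradient fi (x t \<omega>))"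
  have step: "mean_objective (Suc t) \<le> mean_objective t - ?\<eta> / 2 * ?N
      + ?\<eta> * (L\<^sup>2 * mean_disagreement t + ?d * ?u\<^sup>2 * L\<^sup>2 / 4)
      + L * ?\<eta>\<^sup>2 / 2 * (4 * ?d / 3 * ?S + ?u\<^sup>2 * L\<^sup>2 * ?d\<^sup>2)"
    using S.expected_objective_step integrable_objective[of "Suc t"] by simp
  have S_le: "?S \<le> 4 * L * ((mean_objective t - f_star) + (f_star - agent_mean m)) + 2 * L\<^sup>2 * mean_disagreement t"
    using S.expected_mean_sq_gradient_le[OF lb] by simp
  have "2 * \<mu> * (mean_objective t - f_star) = expectation (\<lambda>\<omega>. 2 * \<mu> * (f (agent_mean (x t \<omega>)) - f_star))"
    using integrable_objective by (simp add: prob_space)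
  also have "\<dots> \<le> ?N"
    using integrable_objective S.integrable_sq_gradient_f by (intro integral_mono PL) auto
  finally have "?\<eta> / 2 * (2 * \<mu> * (mean_objective t - f_star)) \<le> ?\<eta> / 2 * ?N"
    using S.\<eta> by (intro mult_left_mono) auto
  moreover have "L * ?\<eta>\<^sup>2 / 2 * (4 * ?d / 3 * ?S + ?u\<^sup>2 * L\<^sup>2 * ?d\<^sup>2)
      \<le> L * ?\<eta>\<^sup>2 / 2 * (4 * ?d / 3 * (4 * L * ((mean_objective t - f_star) + (f_star - agent_mean m))
          + 2 * L\<^sup>2 * mean_disagreement t) + ?u\<^sup>2 * L\<^sup>2 * ?d\<^sup>2)"
    using S_le L by (intro mult_left_mono add_right_mono) auto
  moreover have "(1 - \<mu> * ?\<eta>) * (mean_objective t - f_star)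
      = mean_objective t - f_star - ?\<eta> / 2 * (2 * \<mu> * (mean_objective t - f_star))"
    by (simp add: algebra_simps)
  ultimately show ?thesis using step by linarith
qed

lemma disagreement_recursion:
  assumes lb: "\<And>i y. m i \<le> fi i y" and \<theta>: "\<theta> > 0"
  shows "mean_disagreement (Suc t)
    \<le> (consensus_rate W)\<^sup>2 * ((1 + \<theta>) * mean_disagreement t
      + (\<eta> (Suc t))\<^sup>2 * ((4 * real CARD('d) / 3 + 2 / \<theta>)
          * (4 * L * ((mean_objective t - f_star) + (f_star - agent_mean m)) + 2 * L\<^sup>2 * mean_disagreement t)
        + (u (Suc t))\<^sup>2 * L\<^sup>2 * ((real CARD('d))\<^sup>2 + real CARD('d) / (2 * \<theta>))))"
proof -
  obtain R where "zo_step M fi W L (u (Suc t)) (\<eta> (Suc t)) R (X t) (z (Suc t))"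
    using one_step by blast
  then interpret S: zo_step M fi W L "u (Suc t)" "\<eta> (Suc t)" R "X t" "z (Suc t)" .
  let ?d = "real CARD('d)"
  let ?S = "expectation (\<lambda>\<omega>. mean_sq_gradient fi (x t \<omega>))"
  have S_le: "?S \<le> 4 * L * ((mean_objective t - f_star) + (f_star - agent_mean m)) + 2 * L\<^sup>2 * mean_disagreement t"
    using S.expected_mean_sq_gradient_le[OF lb] by simp
  have "mean_disagreement (Suc t) \<le> (consensus_rate W)\<^sup>2 * ((1 + \<theta>) * mean_disagreement t
      + (\<eta> (Suc t))\<^sup>2 * ((4 * ?d / 3 + 2 / \<theta>) * ?S + (u (Suc t))\<^sup>2 * L\<^sup>2 * (?d\<^sup>2 + ?d / (2 * \<theta>))))"
    using S.expected_disagreement_step[OF _ \<theta>] integrable_disagreement[of "Suc t"] by simp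
  also have "\<dots> \<le> (consensus_rate W)\<^sup>2 * ((1 + \<theta>) * mean_disagreement t
      + (\<eta> (Suc t))\<^sup>2 * ((4 * ?d / 3 + 2 / \<theta>)
          * (4 * L * ((mean_objective t - f_star) + (f_star - agent_mean m)) + 2 * L\<^sup>2 * mean_disagreement t)
        + (u (Suc t))\<^sup>2 * L\<^sup>2 * (?d\<^sup>2 + ?d / (2 * \<theta>))))"
    using \<theta> S_le by (intro mult_left_mono add_left_mono add_right_mono) auto
  finally show ?thesis .
qed

end

theorem theorem2:
  fixes E :: "('n::finite \<times> 'n) set"
    and W :: "real^'n^'n"
    and fi :: "'n \<Rightarrow> real^'d::finite \<Rightarrow> real"
    and f :: "real^'d \<Rightarrow> real"
    and fi_star :: "'n \<Rightarrow> real"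
    and f_star L \<mu> \<rho> \<Delta> t0 \<alpha>\<^sub>\<eta> \<alpha>\<^sub>u d :: real
    and \<eta> u :: "nat \<Rightarrow> real"
    and x0 :: "'n \<Rightarrow> real^'d"
    and M :: "'w measure"
    and z :: "nat \<Rightarrow> 'n \<Rightarrow> 'w \<Rightarrow> real^'d"
    and x :: "nat \<Rightarrow> 'n \<Rightarrow> 'w \<Rightarrow> real^'d"
    and xbar :: "nat \<Rightarrow> 'w \<Rightarrow> real^'d"
  defines "d \<equiv> real CARD('d)"
    and "f \<equiv> \<lambda>y. agent_mean (\<lambda>i. fi i y)"
    and "\<rho> \<equiv> consensus_rate W"
    and "fi_star \<equiv> \<lambda>i. INF y. fi i y"
    and "\<Delta> \<equiv> f_star - agent_mean fi_star"
    and "x \<equiv> \<lambda>t i \<omega>. zo_iter W fi \<eta> u x0 (\<lambda>s j. z s j \<omega>) t i"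
    and "xbar \<equiv> \<lambda>t \<omega>. agent_mean (\<lambda>i. x t i \<omega>)"
  assumes graph: "undirected_connected E"
    and consensus: "consensus_matrix E W"
    and prob: "prob_space M"
    and z_indep: "prob_space.indep_vars M (\<lambda>_. borel) (\<lambda>(t, i). z t i) ({1..} \<times> UNIV)"
    and z_unif: "\<And>t i. t \<ge> 1 \<Longrightarrow> distr M borel (z t i) = uniform_sphere"
    and L_pos: "L > 0"
    and smooth: "\<And>i. smooth_with L (fi i)"
    and bdd: "\<And>i. bdd_below (range (fi i))"
    and dominated: "gradient_dominated \<mu> f"
    and f_min: "f_star \<in> range f" "\<And>y. f_star \<le> f y"
    and alphas: "\<alpha>\<^sub>\<eta> > 1" "\<alpha>\<^sub>u > 0"
    and step: "\<And>t. t \<ge> 1 \<Longrightarrow> \<eta> t = 2 * \<alpha>\<^sub>\<eta> / (\<mu> * (real t + t0))"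
    and radius: "\<And>t. t \<ge> 1 \<Longrightarrow> 0 < u t \<and> u t \<le> \<alpha>\<^sub>u / sqrt (real t + t0)"
    and t0: "t0 \<ge> 2 * \<alpha>\<^sub>\<eta> * L / (\<mu> * (1 - \<rho>\<^sup>2)) * (32 * L * d / (3 * \<mu>) + 9 * \<rho>) - 1"
  shows
    "(\<forall>t. integrable M (\<lambda>\<omega>. f (xbar t \<omega>) - f_star)) \<and>
     (\<exists>r \<in> o(\<lambda>t. 1 / real t). \<forall>\<^sub>F t in sequentially.
        (\<integral>\<omega>. f (xbar t \<omega>) - f_star \<partial>M)
          \<le> (32 * \<alpha>\<^sub>\<eta>\<^sup>2 * L\<^sup>2 * \<Delta> / \<mu>\<^sup>2 + 6 * \<alpha>\<^sub>\<eta> * \<alpha>\<^sub>u\<^sup>2 * L\<^sup>2 / \<mu>) * (d / real t) + r t) \<and>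
     (\<forall>t i. integrable M (\<lambda>\<omega>. (norm (x t i \<omega> - xbar t \<omega>))\<^sup>2)) \<and>
     (\<exists>r \<in> o(\<lambda>t. 1 / (real t)\<^sup>2). \<forall>\<^sub>F t in sequentially.
        agent_mean (\<lambda>i. \<integral>\<omega>. (norm (x t i \<omega> - xbar t \<omega>))\<^sup>2 \<partial>M)
          \<le> 32 * \<alpha>\<^sub>\<eta>\<^sup>2 * \<rho>\<^sup>2 * L * \<Delta> / (\<mu>\<^sup>2 * (1 - \<rho>\<^sup>2))
              * (4 * d / 3 + 6 * \<rho>\<^sup>2 / (1 - \<rho>\<^sup>2)) * (1 / (real t)\<^sup>2) + r t)"
proof -
  interpret prob_space M by (rule prob)
  have W: "doubly_stochastic W" using consensus by (simp add: consensus_matrix_def)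
  have \<mu>: "\<mu> > 0" using dominated by (simp add: gradient_dominated_def)
  have \<rho>: "0 \<le> \<rho>" "\<rho> < 1"
    unfolding \<rho>_def using consensus_rate_nonneg consensus_rate_less_1[OF graph consensus] by auto
  then have \<rho>2: "0 \<le> \<rho>\<^sup>2" "\<rho>\<^sup>2 < 1" by (auto simp: power_less_one_iff)
  have d: "d > 0" by (simp add: d_def)
  have lb: "fi_star i \<le> fi i y" for i y
    unfolding fi_star_def by (rule cINF_lower[OF bdd]) simp
  obtain y0 where y0: "f_star = f y0" using f_min(1) by blast
  have \<Delta>: "\<Delta> \<ge> 0"
    unfolding \<Delta>_def y0 using agent_mean_mono[of fi_star "\<lambda>i. fi i y0"] lb by (simp add: f_def)
  have PL: "2 * \<mu> * (f y - f_star) \<le> (norm (gradient f y))\<^sup>2" for y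
  proof -
    obtain xopt where xopt: "\<And>y. f xopt \<le> f y" "\<And>y. 2 * \<mu> * (f y - f xopt) \<le> (norm (gradient f y))\<^sup>2"
      using dominated unfolding gradient_dominated_def by blast
    have "f xopt = f_star" using xopt(1)[of y0] f_min(2)[of xopt] y0 by simp
    then show ?thesis using xopt(2)[of y] by simp
  qed
  have "2 * \<alpha>\<^sub>\<eta> * L / (\<mu> * (1 - \<rho>\<^sup>2)) * (32 * L * d / (3 * \<mu>) + 9 * \<rho>) > 0"
    using alphas L_pos \<mu> \<rho> \<rho>2 d by (intro mult_pos_pos divide_pos_pos add_pos_nonneg) auto
  then have s_pos: "real t + t0 > 0" if "t \<ge> 1" for t
    using t0 that by linarith
  have \<eta>_pos: "\<eta> t > 0" if "t \<ge> 1" for t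
    using step[OF that] s_pos[OF that] alphas \<mu> by simp
  interpret zo_run M fi W L u \<eta> x0 z
    using smooth L_pos radius \<eta>_pos W z_indep z_unif by unfold_locales auto
  define \<delta> where "\<delta> t = mean_objective t - f_star" for t
  define e where "e t = mean_disagreement t" for t
  have \<delta>_nn: "0 \<le> \<delta> t" for t
  proof -
    have "expectation (\<lambda>\<omega>. f_star) \<le> mean_objective t"
      using integrable_objective f_min(2) by (intro integral_mono) (auto simp: f_def)
    then show ?thesis by (simp add: \<delta>_def prob_space)
  qed
  have e_nn: "0 \<le> e t" for t
    unfolding e_def by (intro Bochner_Integration.integral_nonneg disagreement_nonneg)
  define A where "A = 2 * \<alpha>\<^sub>\<eta> / \<mu>"
  have A: "A > 0" using alphas \<mu> by (simp add: A_def)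
  have \<mu>A: "\<mu> * (A / s) = 2 * \<alpha>\<^sub>\<eta> / s" for s
    using \<mu> by (simp add: A_def)
  have sched: "\<eta> (Suc t) = A / (real (Suc t) + t0)"
    "(u (Suc t))\<^sup>2 \<le> \<alpha>\<^sub>u\<^sup>2 / (real (Suc t) + t0)" for t
  proof -
    show "\<eta> (Suc t) = A / (real (Suc t) + t0)"
      using step[of "Suc t"] \<mu> by (auto simp: A_def)
    have "(u (Suc t))\<^sup>2 \<le> (\<alpha>\<^sub>u / sqrt (real (Suc t) + t0))\<^sup>2"
      using radius[of "Suc t"] by (intro power_mono) auto
    then show "(u (Suc t))\<^sup>2 \<le> \<alpha>\<^sub>u\<^sup>2 / (real (Suc t) + t0)"
      using s_pos[of "Suc t"] by (simp add: power_divide)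
  qed
  \<comment> \<open>The coefficient of \<open>1/s\<^sup>2\<close> that survives in the limit: gradient noise at the optimum,
    and squared estimator bias.\<close>
  define K1 where "K1 = 8 / 3 * A\<^sup>2 * d * L\<^sup>2 * \<Delta> + A * d * \<alpha>\<^sub>u\<^sup>2 * L\<^sup>2 / 4"
  have rec_\<delta>: "\<delta> (Suc t) \<le> (1 - 2 * \<alpha>\<^sub>\<eta> / (real (Suc t) + t0) + (8 / 3 * A\<^sup>2 * d * L\<^sup>2) / (real (Suc t) + t0)\<^sup>2) * \<delta> t
      + (A * L\<^sup>2 / (real (Suc t) + t0) + (4 / 3 * A\<^sup>2 * d * L ^ 3) / (real (Suc t) + t0)\<^sup>2) * e t
      + (K1 + (A\<^sup>2 * L ^ 3 * d\<^sup>2 * \<alpha>\<^sub>u\<^sup>2 / 2) / (real (Suc t) + t0)) / (real (Suc t) + t0)\<^sup>2" for t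
  proof -
    define s where "s = real (Suc t) + t0"
    have s: "s > 0" unfolding s_def by (rule s_pos) simp
    define U where "U = (u (Suc t))\<^sup>2"
    have U: "U \<le> \<alpha>\<^sub>u\<^sup>2 / s" using sched(2)[of t] by (simp add: U_def s_def)
    have "\<delta> (Suc t) \<le> (1 - 2 * \<alpha>\<^sub>\<eta> / s) * \<delta> t + A / s * (L\<^sup>2 * e t + d * U * L\<^sup>2 / 4)
        + L * (A / s)\<^sup>2 / 2 * (4 * d / 3 * (4 * L * (\<delta> t + \<Delta>) + 2 * L\<^sup>2 * e t) + U * L\<^sup>2 * d\<^sup>2)"
      using objective_recursion[OF lb PL[unfolded f_def], of t]
      unfolding sched(1) \<mu>A \<delta>_def[symmetric] e_def[symmetric] \<Delta>_def[symmetric] d_def[symmetric]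
        s_def[symmetric] U_def[symmetric] .
    also have "\<dots> \<le> (1 - 2 * \<alpha>\<^sub>\<eta> / s) * \<delta> t + A / s * (L\<^sup>2 * e t + d * (\<alpha>\<^sub>u\<^sup>2 / s) * L\<^sup>2 / 4)
        + L * (A / s)\<^sup>2 / 2 * (4 * d / 3 * (4 * L * (\<delta> t + \<Delta>) + 2 * L\<^sup>2 * e t) + (\<alpha>\<^sub>u\<^sup>2 / s) * L\<^sup>2 * d\<^sup>2)"
      using U A s d L_pos
      by (intro add_mono mult_left_mono divide_right_mono mult_right_mono order_refl) auto
    also have "\<dots> = (1 - 2 * \<alpha>\<^sub>\<eta> / s + (8 / 3 * A\<^sup>2 * d * L\<^sup>2) / s\<^sup>2) * \<delta> t
      + (A * L\<^sup>2 / s + (4 / 3 * A\<^sup>2 * d * L ^ 3) / s\<^sup>2) * e t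
      + (K1 + (A\<^sup>2 * L ^ 3 * d\<^sup>2 * \<alpha>\<^sub>u\<^sup>2 / 2) / s) / s\<^sup>2"
      using s by (simp add: K1_def field_simps power2_eq_square power3_eq_cube)
    finally show ?thesis unfolding s_def .
  qed
  \<comment> \<open>This \<open>\<theta>\<close> solves \<open>\<rho>\<^sup>2 (1 + \<theta>) = (1 + \<rho>\<^sup>2)/2\<close>. For \<open>\<rho> = 0\<close> there is no solution, but then the
    left-hand side vanishes and any positive value will do.\<close>
  define \<theta> where "\<theta> = (if \<rho> = 0 then 1 else (1 - \<rho>\<^sup>2) / (2 * \<rho>\<^sup>2))"
  define q where "q = (1 + \<rho>\<^sup>2) / 2"
  have \<theta>: "\<theta> > 0" using \<rho>2 by (auto simp: \<theta>_def)
  have q: "0 \<le> q" "q < 1" using \<rho>2 by (auto simp: q_def)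
  have \<theta>q: "\<rho>\<^sup>2 * (1 + \<theta>) \<le> q"
    by (simp add: \<theta>_def q_def field_simps)
  have \<theta>C: "\<rho>\<^sup>2 * (4 * d / 3 + 2 / \<theta>) = \<rho>\<^sup>2 * (4 * d / 3 + 4 * \<rho>\<^sup>2 / (1 - \<rho>\<^sup>2))"
    by (simp add: \<theta>_def)
  define C where "C = \<rho>\<^sup>2 * (4 * d / 3 + 4 * \<rho>\<^sup>2 / (1 - \<rho>\<^sup>2))"
  have C: "C \<ge> 0" using \<rho>2 d by (simp add: C_def)
  define C' where "C' = \<rho>\<^sup>2 * L\<^sup>2 * (d\<^sup>2 + d / (2 * \<theta>))"
  have C': "C' \<ge> 0" using d \<theta> by (simp add: C'_def)
  define K2 where "K2 = A\<^sup>2 * C * (4 * L) * \<Delta>"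
  have rec_e: "e (Suc t) \<le> q * e t + (K2 + (A\<^sup>2 * C * (4 * L)) * \<delta> t + (A\<^sup>2 * C * (2 * L\<^sup>2)) * e t
      + (A\<^sup>2 * C' * \<alpha>\<^sub>u\<^sup>2) / (real (Suc t) + t0)) / (real (Suc t) + t0)\<^sup>2" for t
  proof -
    define s where "s = real (Suc t) + t0"
    have s: "s > 0" unfolding s_def by (rule s_pos) simp
    define U where "U = (u (Suc t))\<^sup>2"
    have U: "U \<le> \<alpha>\<^sub>u\<^sup>2 / s" using sched(2)[of t] by (simp add: U_def s_def)
    have "e (Suc t) \<le> \<rho>\<^sup>2 * ((1 + \<theta>) * e t + (A / s)\<^sup>2 * ((4 * d / 3 + 2 / \<theta>)
        * (4 * L * (\<delta> t + \<Delta>) + 2 * L\<^sup>2 * e t) + U * L\<^sup>2 * (d\<^sup>2 + d / (2 * \<theta>))))"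
      using disagreement_recursion[OF lb \<theta>, of t f_star]
      unfolding sched(1) \<delta>_def[symmetric] e_def[symmetric] \<Delta>_def[symmetric] d_def[symmetric]
        s_def[symmetric] U_def[symmetric] \<rho>_def[symmetric] .
    also have "\<dots> = (\<rho>\<^sup>2 * (1 + \<theta>)) * e t + (A / s)\<^sup>2 * ((\<rho>\<^sup>2 * (4 * d / 3 + 2 / \<theta>))
        * (4 * L * (\<delta> t + \<Delta>) + 2 * L\<^sup>2 * e t) + U * C')"
      unfolding C'_def by (simp only: algebra_simps)
    also have "\<dots> \<le> q * e t + (A / s)\<^sup>2 * (C * (4 * L * (\<delta> t + \<Delta>) + 2 * L\<^sup>2 * e t) + (\<alpha>\<^sub>u\<^sup>2 / s) * C')"
      unfolding \<theta>C C_def[symmetric]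
      using \<theta>q e_nn U C' by (intro add_mono mult_left_mono mult_right_mono order_refl) auto
    also have "\<dots> = q * e t + (K2 + (A\<^sup>2 * C * (4 * L)) * \<delta> t + (A\<^sup>2 * C * (2 * L\<^sup>2)) * e t
      + (A\<^sup>2 * C' * \<alpha>\<^sub>u\<^sup>2) / s) / s\<^sup>2"
      using s by (simp add: K2_def power_divide add_divide_distrib distrib_left mult_ac)
    finally show ?thesis unfolding s_def .
  qed
  have K1: "0 \<le> K1" using A d \<Delta> by (simp add: K1_def)
  have K2: "0 \<le> K2" using A C L_pos \<Delta> by (simp add: K2_def)
  have b: "2 * \<alpha>\<^sub>\<eta> > 1" using alphas by simp
  have coeffs: "0 \<le> 8 / 3 * A\<^sup>2 * d * L\<^sup>2" "0 \<le> A * L\<^sup>2" "0 \<le> 4 / 3 * A\<^sup>2 * d * L ^ 3"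
    "0 \<le> A\<^sup>2 * L ^ 3 * d\<^sup>2 * \<alpha>\<^sub>u\<^sup>2 / 2" "0 \<le> A\<^sup>2 * C * (4 * L)" "0 \<le> A\<^sup>2 * C * (2 * L\<^sup>2)" "0 \<le> A\<^sup>2 * C' * \<alpha>\<^sub>u\<^sup>2"
    using A C C' d L_pos by auto
  note rates = coupled_recursion_rates[OF \<delta>_nn e_nn b q K1 K2 coeffs
      always_eventually[OF allI[OF rec_\<delta>]] always_eventually[OF allI[OF rec_e]]]
  let ?T1 = "(32 * \<alpha>\<^sub>\<eta>\<^sup>2 * L\<^sup>2 * \<Delta> / \<mu>\<^sup>2 + 6 * \<alpha>\<^sub>\<eta> * \<alpha>\<^sub>u\<^sup>2 * L\<^sup>2 / \<mu>) * d"
  let ?T2 = "32 * \<alpha>\<^sub>\<eta>\<^sup>2 * \<rho>\<^sup>2 * L * \<Delta> / (\<mu>\<^sup>2 * (1 - \<rho>\<^sup>2)) * (4 * d / 3 + 6 * \<rho>\<^sup>2 / (1 - \<rho>\<^sup>2))"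
  have T1: "K1 / (2 * \<alpha>\<^sub>\<eta> - 1) \<le> ?T1"
  proof -
    have "K1 / (2 * \<alpha>\<^sub>\<eta> - 1) \<le> K1 / 1"
      using K1 alphas by (intro divide_left_mono) auto
    also have "\<dots> = (32 / 3 * \<alpha>\<^sub>\<eta>\<^sup>2 * L\<^sup>2 * \<Delta> / \<mu>\<^sup>2 + 1 / 2 * \<alpha>\<^sub>\<eta> * \<alpha>\<^sub>u\<^sup>2 * L\<^sup>2 / \<mu>) * d"
      by (simp add: K1_def A_def power_divide power_mult_distrib algebra_simps)
    also have "\<dots> \<le> ?T1"
      using alphas \<mu> d \<Delta> by (intro mult_right_mono add_mono divide_right_mono) auto
    finally show ?thesis .
  qed
  have T2: "K2 / (1 - q) \<le> ?T2"
  proof -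
    have "1 - q = (1 - \<rho>\<^sup>2) / 2" by (simp add: q_def field_simps)
    then have "K2 / (1 - q) = K2 / ((1 - \<rho>\<^sup>2) / 2)" by (simp only:)
    then have "K2 / (1 - q) = 2 * K2 / (1 - \<rho>\<^sup>2)" by simp
    also have "\<dots> = 32 * \<alpha>\<^sub>\<eta>\<^sup>2 * \<rho>\<^sup>2 * L * \<Delta> / (\<mu>\<^sup>2 * (1 - \<rho>\<^sup>2)) * (4 * d / 3 + 4 * \<rho>\<^sup>2 / (1 - \<rho>\<^sup>2))"
      by (simp add: K2_def A_def C_def power_divide power_mult_distrib)
    also have "\<dots> \<le> ?T2"
      using \<rho>2 L_pos \<Delta> \<mu> by (intro mult_left_mono add_left_mono divide_right_mono) auto
    finally show ?thesis .
  qed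
  have lim: "(\<lambda>t. 1 / real t * (real t + t0)) \<longlonglongrightarrow> 1"
  proof -
    have "(\<lambda>t. 1 + t0 * (1 / real t)) \<longlonglongrightarrow> 1 + t0 * 0"
      by (intro tendsto_intros lim_1_over_n)
    moreover have "eventually (\<lambda>t. 1 + t0 * (1 / real t) = 1 / real t * (real t + t0)) sequentially"
      using eventually_gt_at_top[of 0] by eventually_elim (simp add: field_simps)
    ultimately show ?thesis by (simp add: tendsto_cong)
  qed
  have lim2: "(\<lambda>t. 1 / (real t)\<^sup>2 * (real t + t0)\<^sup>2) \<longlonglongrightarrow> 1"
    using tendsto_power[OF lim, of 2] by (simp add: power_mult_distrib power_divide)
  have pos: "eventually (\<lambda>t. real t + t0 > 0) sequentially" "eventually (\<lambda>t. (real t + t0)\<^sup>2 > 0) sequentially"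
    "eventually (\<lambda>t. 1 / real t > 0) sequentially" "eventually (\<lambda>t. 1 / (real t)\<^sup>2 > 0) sequentially"
    using eventually_ge_at_top[of 1] by (eventually_elim, use s_pos in force)+
  have "\<exists>r\<in>o(\<lambda>t. 1 / real t). eventually (\<lambda>t. \<delta> t \<le> ?T1 * (1 / real t) + r t) sequentially"
  proof (rule eventually_rate_imp_smallo[OF lim _ pos(1,3)])
    show "0 \<le> ?T1" using alphas \<mu> d \<Delta> by simp
    show "eventually (\<lambda>t. (real t + t0) * \<delta> t \<le> ?T1 + \<epsilon>) sequentially" if "\<epsilon> > 0" for \<epsilon>
      using rates(1)[OF that] T1 by (auto elim: eventually_mono)
  qed
  moreover have "\<exists>r\<in>o(\<lambda>t. 1 / (real t)\<^sup>2). eventually (\<lambda>t. e t \<le> ?T2 * (1 / (real t)\<^sup>2) + r t) sequentially"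
  proof (rule eventually_rate_imp_smallo[OF lim2 _ pos(2,4)])
    show "0 \<le> ?T2" using \<rho>2 L_pos \<Delta> \<mu> d by simp
    show "eventually (\<lambda>t. (real t + t0)\<^sup>2 * e t \<le> ?T2 + \<epsilon>) sequentially" if "\<epsilon> > 0" for \<epsilon>
      using rates(2)[OF that] T2 by (auto elim: eventually_mono)
  qed
  moreover have "(\<integral>\<omega>. f (xbar t \<omega>) - f_star \<partial>M) = \<delta> t" for t
    unfolding \<delta>_def f_def xbar_def x_def using integrable_objective by (simp add: prob_space)
  moreover have "agent_mean (\<lambda>i. \<integral>\<omega>. (norm (x t i \<omega> - xbar t \<omega>))\<^sup>2 \<partial>M) = e t" for t
    unfolding e_def disagreement_def xbar_def x_def
    by (intro integral_agent_mean(2)[symmetric] integrable_deviation)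
  moreover have "integrable M (\<lambda>\<omega>. f (xbar t \<omega>) - f_star)" for t
    unfolding f_def xbar_def x_def using integrable_objective by simp
  moreover have "integrable M (\<lambda>\<omega>. (norm (x t i \<omega> - xbar t \<omega>))\<^sup>2)" for t i
    unfolding xbar_def x_def by (rule integrable_deviation)
  ultimately show ?thesis by simp
qed

end
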